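(* Let $\eta$ be a non-periodic Toeplitz sequence with period structure $(p_n)_{n\ge1}$. Assume that for every $n\in\mathbb N$ there is a primitive set $A_n$ of positive integers and, for each $a\in A_n$, a set $S_n(a)$ of positive integers such that $$\widetilde{\mathcal H}_n=\bigcup_{a\in A_n}\bigl(a\mathbb Z\setminus\mathcal M_{S_n(a)}\bigr)\quad\text{and}\quad a\mathbb Z\setminus\mathcal M_{S_n(a)}\ne\emptyset\ \ (a\in A_n).$$ If $$\lim_{n\to\infty}\sum_{a'\in A_n}\frac1{\varphi(a')}=0,$$ then for all $k\in\mathbb Z\setminus\{0\}$ the set $\partial W\cap(\partial W-\Delta(k))$ is nowhere dense with respect to the subspace topology of $\partial W$. Moreover, if the automorphism $F$ of $(X_\eta,\sigma)$ is described by a block code $\{0,1\}^{[-m:m]}\to\{0,1\}$, then the set $K$ is contained in $[-m,m]$, $\operatorname{int}_{\partial W}(V_{k_i})\cap\operatorname{int}_{\partial W}(V_{k_j})=\emptyset$ for any different $k_i,k_j\in K$, and $\partial W=\bigcup_{k\in K}V_k'$, where $V_k'=\overline{\operatorname{int}_{\partial W}(V_k)}$.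
   Context: $\mathbb N=\{1,2,\dots\}$; $\varphi$ is Euler's totient function. For a set $A$ of positive integers, $\mathcal M_A=\bigcup_{a\in A}a\mathbb Z$; $A$ is primitive if no element divides a different element. A non-periodic Toeplitz sequence with period structure $p_1\mid p_2\mid\dots\to\infty$ is a non-periodic $\eta\in\{0,1\}^{\mathbb Z}$ such that for each $k\in\mathbb Z$ there is $n\ge1$ with $\eta|_{k+p_n\mathbb Z}$ constant. $\sigma$ is the left shift and $X_\eta$ the orbit closure of $\eta$. For $i=0,1$: $\mathcal P_n^i=\{k\in\mathbb Z:\eta|_{k+p_n\mathbb Z}=i\}$; $\mathcal H_n=\mathbb Z\setminus(\mathcal P_n^0\cup\mathcal P_n^1)$ (holes at level $n$); essential holes: $\widetilde{\mathcal H}_N=\{k\in\mathcal H_N:\mathcal H_n\cap(k+p_N\mathbb Z)\neq\emptyset\ \forall n\ge N\}$. $G=\varprojlim\mathbb Z/p_n\mathbb Z$; $\Delta(k)=(k+p_n\mathbb Z)_n$; $Tg=g+\Delta(1)$; $U_n(h)=\{g\in G:g_n=h_n\}$; $V^i=\bigcup_{n}\bigcup_{k\in\mathcal P_n^i\cap[0,p_n)}U_n(\Delta(k))$; $W=\overline{V^1}=G\setminus V^0$ with boundary $\partial W=G\setminus(V^0\cup V^1)$. Standing assumption: $(G,T)$ is the maximal equicontinuous factor of $(X_\eta,\sigma)$, with factor map $\pi$ determined by $\pi(\eta)=\Delta(0)$. An automorphism is a homeomorphism $F$ of $X_\eta$ commuting with $\sigma$; $y_F\in G$ is the unique element with $\pi(F(x))=\pi(x)+y_F$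 for all $x\in X_\eta$. $F$ is described by a block code $c:\{0,1\}^{[-m:m]}\to\{0,1\}$ if $(Fx)_s=c(x_{s-m},\dots,x_{s+m})$ for all $x\in X_\eta$, $s\in\mathbb Z$. For $k\in\mathbb Z$: $V_k=\partial W\cap(\partial W+\Delta(k)-y_F)$; $\operatorname{int}_{\partial W}$ is the interior in the subspace topology of $\partial W$; $K=\{k\in\mathbb Z:\operatorname{int}_{\partial W}(V_k)\neq\emptyset\}$. *)

theory Defs
  imports "HOL-Analysis.Analysis" "HOL-Number_Theory.Totient"
begin

text \<open>
  The alphabet \<open>{0,1}\<close> is \<^typ>\<open>bool\<close> (\<open>True\<close> is 1) with its discrete topology, and two-sided
  sequences carry the product topology of \<^typ>\<open>int \<Rightarrow> bool\<close>.
  Period structures are indexed from 0, so \<open>p n\<close> is \<open>p\<^sub>n\<^sub>+\<^sub>1\<close> in one-based notation; the same shift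
  applies to all other level-indexed objects.
\<close>

section \<open>Toeplitz sequences\<close>

definition shift :: "(int \<Rightarrow> bool) \<Rightarrow> (int \<Rightarrow> bool)" where
  "shift x = (\<lambda>k. x (k + 1))"

definition orbit_closure :: "(int \<Rightarrow> bool) \<Rightarrow> (int \<Rightarrow> bool) set" where
  "orbit_closure \<eta> = closure (range (\<lambda>j k. \<eta> (k + j)))"

definition periodic_seq :: "(int \<Rightarrow> bool) \<Rightarrow> bool" where
  "periodic_seq \<eta> \<longleftrightarrow> (\<exists>q>0. \<forall>k. \<eta> (k + q) = \<eta> k)"

text \<open>The divergence of \<open>p\<close> together with divisibility forces all \<open>p n\<close> to be positive.\<close>

definition toeplitz :: "(nat \<Rightarrow> nat) \<Rightarrow> (int \<Rightarrow> bool) \<Rightarrow> bool" where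
  "toeplitz p \<eta> \<longleftrightarrow>
     (\<forall>n. p n dvd p (Suc n)) \<and> filterlim p at_top sequentially \<and>
     \<not> periodic_seq \<eta> \<and>
     (\<forall>k. \<exists>n. \<forall>j. \<eta> (k + int (p n) * j) = \<eta> k)"

definition per_part :: "(nat \<Rightarrow> nat) \<Rightarrow> (int \<Rightarrow> bool) \<Rightarrow> bool \<Rightarrow> nat \<Rightarrow> int set" where
  "per_part p \<eta> i n = {k. \<forall>j. \<eta> (k + int (p n) * j) = i}"

definition holes :: "(nat \<Rightarrow> nat) \<Rightarrow> (int \<Rightarrow> bool) \<Rightarrow> nat \<Rightarrow> int set" where
  "holes p \<eta> n = - (per_part p \<eta> False n \<union> per_part p \<eta> True n)"

definition essential_holes :: "(nat \<Rightarrow> nat) \<Rightarrow> (int \<Rightarrow> bool) \<Rightarrow> nat \<Rightarrow> int set" where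
  "essential_holes p \<eta> N =
     {k \<in> holes p \<eta> N. \<forall>n\<ge>N. holes p \<eta> n \<inter> range (\<lambda>j. k + int (p N) * j) \<noteq> {}}"


section \<open>Sets of multiples\<close>

definition multiples :: "nat set \<Rightarrow> int set" where
  "multiples A = (\<Union>a\<in>A. {k. int a dvd k})"

definition primitive_set :: "nat set \<Rightarrow> bool" where
  "primitive_set A \<longleftrightarrow> (\<forall>a\<in>A. \<forall>b\<in>A. a dvd b \<longrightarrow> a = b)"


section \<open>The odometer\<close>

text \<open>
  An element of the inverse limit of the groups \<open>\<int>/p\<^sub>n\<int>\<close> is represented by the sequence of the
  least nonnegative representatives of its components. As \<^typ>\<open>int\<close> is discrete, the topology is
  the subspace topology of \<^typ>\<open>nat \<Rightarrow> int\<close>.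
\<close>

definition odometer :: "(nat \<Rightarrow> nat) \<Rightarrow> (nat \<Rightarrow> int) set" where
  "odometer p = {g. \<forall>n. 0 \<le> g n \<and> g n < int (p n) \<and> g (Suc n) mod int (p n) = g n}"

abbreviation odometer_top :: "(nat \<Rightarrow> nat) \<Rightarrow> (nat \<Rightarrow> int) topology" where
  "odometer_top p \<equiv> top_of_set (odometer p)"

definition odo_add :: "(nat \<Rightarrow> nat) \<Rightarrow> (nat \<Rightarrow> int) \<Rightarrow> (nat \<Rightarrow> int) \<Rightarrow> (nat \<Rightarrow> int)" where
  "odo_add p g h = (\<lambda>n. (g n + h n) mod int (p n))"

definition odo_minus :: "(nat \<Rightarrow> nat) \<Rightarrow> (nat \<Rightarrow> int) \<Rightarrow> (nat \<Rightarrow> int) \<Rightarrow> (nat \<Rightarrow> int)" where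
  "odo_minus p g h = (\<lambda>n. (g n - h n) mod int (p n))"

definition Delta :: "(nat \<Rightarrow> nat) \<Rightarrow> int \<Rightarrow> (nat \<Rightarrow> int)" where
  "Delta p k = (\<lambda>n. k mod int (p n))"

definition odo_T :: "(nat \<Rightarrow> nat) \<Rightarrow> (nat \<Rightarrow> int) \<Rightarrow> (nat \<Rightarrow> int)" where
  "odo_T p g = odo_add p g (Delta p 1)"

definition cyl :: "(nat \<Rightarrow> nat) \<Rightarrow> nat \<Rightarrow> (nat \<Rightarrow> int) \<Rightarrow> (nat \<Rightarrow> int) set" where
  "cyl p n h = {g \<in> odometer p. g n = h n}"

definition V_part :: "(nat \<Rightarrow> nat) \<Rightarrow> (int \<Rightarrow> bool) \<Rightarrow> bool \<Rightarrow> (nat \<Rightarrow> int) set" where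
  "V_part p \<eta> i = (\<Union>n. \<Union>k \<in> per_part p \<eta> i n \<inter> {0..<int (p n)}. cyl p n (Delta p k))"

definition W :: "(nat \<Rightarrow> nat) \<Rightarrow> (int \<Rightarrow> bool) \<Rightarrow> (nat \<Rightarrow> int) set" where
  "W p \<eta> = odometer_top p closure_of V_part p \<eta> True"

definition bdW :: "(nat \<Rightarrow> nat) \<Rightarrow> (int \<Rightarrow> bool) \<Rightarrow> (nat \<Rightarrow> int) set" where
  "bdW p \<eta> = odometer_top p frontier_of W p \<eta>"

definition nowhere_dense_in :: "'a topology \<Rightarrow> 'a set \<Rightarrow> bool" where
  "nowhere_dense_in X A \<longleftrightarrow> A \<subseteq> topspace X \<and> X interior_of (X closure_of A) = {}"


section \<open>Maximal equicontinuous factors\<close>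

text \<open>
  For compact spaces equicontinuity does not depend on the choice of the compatible metric.
\<close>

definition equicontinuous_system :: "'a topology \<Rightarrow> ('a \<Rightarrow> 'a) \<Rightarrow> bool" where
  "equicontinuous_system Y S \<longleftrightarrow>
     compact_space Y \<and> homeomorphic_map Y Y S \<and>
     (\<exists>d. Metric_space (topspace Y) d \<and> Metric_space.mtopology (topspace Y) d = Y \<and>
        (\<forall>\<epsilon>>0. \<exists>\<delta>>0. \<forall>x\<in>topspace Y. \<forall>y\<in>topspace Y. d x y < \<delta> \<longrightarrow>
           (\<forall>n. d ((S ^^ n) x) ((S ^^ n) y) < \<epsilon> \<and>
                d ((inv_into (topspace Y) S ^^ n) x) ((inv_into (topspace Y) S ^^ n) y) < \<epsilon>)))"

definition factor_map ::
    "'a topology \<Rightarrow> ('a \<Rightarrow> 'a) \<Rightarrow> 'b topology \<Rightarrow> ('b \<Rightarrow> 'b) \<Rightarrow> ('a \<Rightarrow> 'b) \<Rightarrow> bool" where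
  "factor_map X f Y g \<rho> \<longleftrightarrow>
     continuous_map X Y \<rho> \<and> \<rho> ` topspace X = topspace Y \<and>
     (\<forall>x\<in>topspace X. \<rho> (f x) = g (\<rho> x))"

text \<open>
  Every factor of a system on (a subset of) \<^typ>\<open>'a\<close> is isomorphic to one whose points are also
  taken from \<^typ>\<open>'a\<close> (choose one point in each fibre), so letting the competing factor \<open>Z\<close>
  range over topologies on \<^typ>\<open>'a\<close> is no restriction.
\<close>

definition maximal_equicontinuous_factor ::
    "'a topology \<Rightarrow> ('a \<Rightarrow> 'a) \<Rightarrow> 'b topology \<Rightarrow> ('b \<Rightarrow> 'b) \<Rightarrow> ('a \<Rightarrow> 'b) \<Rightarrow> bool" where
  "maximal_equicontinuous_factor X f Y g \<pi> \<longleftrightarrow>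
     equicontinuous_system Y g \<and> factor_map X f Y g \<pi> \<and>
     (\<forall>(Z :: 'a topology) h \<rho>. equicontinuous_system Z h \<and> factor_map X f Z h \<rho> \<longrightarrow>
        (\<exists>\<psi>. factor_map Y g Z h \<psi> \<and> (\<forall>x\<in>topspace X. \<rho> x = \<psi> (\<pi> x))))"


section \<open>Automorphisms\<close>

definition automorphism :: "(int \<Rightarrow> bool) \<Rightarrow> ((int \<Rightarrow> bool) \<Rightarrow> (int \<Rightarrow> bool)) \<Rightarrow> bool" where
  "automorphism \<eta> F \<longleftrightarrow>
     homeomorphic_map (top_of_set (orbit_closure \<eta>)) (top_of_set (orbit_closure \<eta>)) F \<and>
     (\<forall>x\<in>orbit_closure \<eta>. F (shift x) = shift (F x))"

text \<open>
  Only the values of the code \<open>c\<close> on words, i.e. on the extensional functions with domain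
  \<open>{-m..m}\<close>, matter.
\<close>

definition has_block_code :: "(int \<Rightarrow> bool) \<Rightarrow> ((int \<Rightarrow> bool) \<Rightarrow> (int \<Rightarrow> bool)) \<Rightarrow> nat \<Rightarrow> bool" where
  "has_block_code \<eta> F m \<longleftrightarrow>
     (\<exists>c :: (int \<Rightarrow> bool) \<Rightarrow> bool. \<forall>x\<in>orbit_closure \<eta>. \<forall>s.
        F x s = c (\<lambda>i\<in>{- int m..int m}. x (s + i)))"

definition aut_rotation ::
    "(nat \<Rightarrow> nat) \<Rightarrow> (int \<Rightarrow> bool) \<Rightarrow> ((int \<Rightarrow> bool) \<Rightarrow> (nat \<Rightarrow> int)) \<Rightarrow>
      ((int \<Rightarrow> bool) \<Rightarrow> (int \<Rightarrow> bool)) \<Rightarrow> (nat \<Rightarrow> int)" where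
  "aut_rotation p \<eta> \<pi> F =
     (THE y. y \<in> odometer p \<and> (\<forall>x\<in>orbit_closure \<eta>. \<pi> (F x) = odo_add p (\<pi> x) y))"

definition V_set :: "(nat \<Rightarrow> nat) \<Rightarrow> (int \<Rightarrow> bool) \<Rightarrow> (nat \<Rightarrow> int) \<Rightarrow> int \<Rightarrow> (nat \<Rightarrow> int) set" where
  "V_set p \<eta> y k =
     bdW p \<eta> \<inter> (\<lambda>g. odo_minus p (odo_add p g (Delta p k)) y) ` bdW p \<eta>"

definition V_int :: "(nat \<Rightarrow> nat) \<Rightarrow> (int \<Rightarrow> bool) \<Rightarrow> (nat \<Rightarrow> int) \<Rightarrow> int \<Rightarrow> (nat \<Rightarrow> int) set" where
  "V_int p \<eta> y k = top_of_set (bdW p \<eta>) interior_of V_set p \<eta> y k"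

definition K_set :: "(nat \<Rightarrow> nat) \<Rightarrow> (int \<Rightarrow> bool) \<Rightarrow> (nat \<Rightarrow> int) \<Rightarrow> int set" where
  "K_set p \<eta> y = {k. V_int p \<eta> y k \<noteq> {}}"


section \<open>Explicit description of the boundary\<close>

lemma toeplitz_dvd:
  assumes "toeplitz p \<eta>" "n \<le> m" shows "p n dvd p m"
  using assms(2)
proof (induction m rule: dec_induct)
  case (step m)
  then show ?case using assms(1) unfolding toeplitz_def by (meson dvd_trans)
qed simp

lemma toeplitz_pos:
  assumes "toeplitz p \<eta>" shows "p n > 0"
proof (rule ccontr)
  assume "\<not> p n > 0"
  then have z: "p m = 0" if "m \<ge> n" for m
    using toeplitz_dvd[OF assms that] by simp
  have "eventually (\<lambda>m. p m \<ge> 1) sequentially"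
    using assms by (simp add: toeplitz_def filterlim_at_top)
  then obtain N where "\<And>m. m \<ge> N \<Longrightarrow> p m \<ge> 1"
    by (auto simp: eventually_sequentially)
  then have "p (max n N) \<ge> 1" by simp
  then show False using z[of "max n N"] by simp
qed

lemma odometer_coherent:
  assumes "toeplitz p \<eta>" "g \<in> odometer p" "n \<le> m" shows "g m mod int (p n) = g n"
  using assms(3)
proof (induction m rule: dec_induct)
  case base
  then show ?case using assms(2) by (simp add: odometer_def)
next
  case (step m)
  have "int (p n) dvd int (p m)"
    using toeplitz_dvd[OF assms(1)] step.hyps by simp
  then have "g (Suc m) mod int (p m) mod int (p n) = g (Suc m) mod int (p n)"
    by (rule mod_mod_cancel)
  moreover have "g (Suc m) mod int (p m) = g m"
    using assms(2) by (simp add: odometer_def)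
  ultimately show ?case using step.IH by simp
qed

lemma Delta_in_odometer:
  assumes "toeplitz p \<eta>" shows "Delta p k \<in> odometer p"
  using toeplitz_pos[OF assms] toeplitz_dvd[OF assms]
  by (auto simp: odometer_def Delta_def mod_mod_cancel)

lemma openin_cyl: "openin (odometer_top p) (cyl p n h)"
proof -
  have "open ((\<lambda>g :: nat \<Rightarrow> int. g n) -` {h n})"
    by (rule open_vimage) (auto simp: open_discrete intro!: continuous_on_product_coordinates)
  moreover have "cyl p n h = odometer p \<inter> (\<lambda>g. g n) -` {h n}"
    by (auto simp: cyl_def)
  ultimately show ?thesis by (metis openin_open_Int)
qed

lemma openin_contains_cyl:
  assumes "toeplitz p \<eta>" "openin (odometer_top p) U" "g \<in> U"
  shows "\<exists>n. cyl p n g \<subseteq> U"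
proof -
  obtain T where T: "open T" "U = odometer p \<inter> T"
    using assms(2) by (auto simp: openin_open)
  then have "openin (product_topology (\<lambda>_. euclidean) UNIV) T" "g \<in> T"
    using assms(3) by (auto simp: open_fun_def)
  then obtain B where B: "g \<in> Pi\<^sub>E UNIV B" "finite {i. B i \<noteq> UNIV}" "Pi\<^sub>E UNIV B \<subseteq> T"
    by (force dest: product_topology_open_contains_basis)
  define N where "N = Max (insert 0 {i. B i \<noteq> UNIV})"
  have N: "i \<le> N" if "B i \<noteq> UNIV" for i
    using that B(2) by (auto simp: N_def)
  have g: "g \<in> odometer p" using assms(3) T by auto
  have "x \<in> U" if x: "x \<in> cyl p N g" for x
  proof -
    have x': "x \<in> odometer p" "x N = g N" using x by (auto simp: cyl_def)
    have "x i \<in> B i" for i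
    proof (cases "B i = UNIV")
      case False
      then have "x i = g i"
        using odometer_coherent[OF assms(1) x'(1)] odometer_coherent[OF assms(1) g] N x'(2) by metis
      then show ?thesis using B(1) by auto
    qed auto
    then show ?thesis using B(3) x' T by auto
  qed
  then show ?thesis by blast
qed

lemma V_part_subset: "V_part p \<eta> i \<subseteq> odometer p"
  by (auto simp: V_part_def cyl_def)

lemma openin_V_part: "openin (odometer_top p) (V_part p \<eta> i)"
  unfolding V_part_def using openin_cyl by blast

lemma V_part_iff:
  assumes "toeplitz p \<eta>"
  shows "g \<in> V_part p \<eta> i \<longleftrightarrow> g \<in> odometer p \<and> (\<exists>n. g n \<in> per_part p \<eta> i n)"
proof
  assume "g \<in> V_part p \<eta> i"
  then show "g \<in> odometer p \<and> (\<exists>n. g n \<in> per_part p \<eta> i n)"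
    by (auto simp: V_part_def cyl_def Delta_def)
next
  assume *: "g \<in> odometer p \<and> (\<exists>n. g n \<in> per_part p \<eta> i n)"
  then obtain n where n: "g n \<in> per_part p \<eta> i n" by blast
  have "g n \<in> {0..<int (p n)}" using * by (simp add: odometer_def)
  then have "g \<in> cyl p n (Delta p (g n))" using * by (auto simp: cyl_def Delta_def)
  then show "g \<in> V_part p \<eta> i"
    unfolding V_part_def using n \<open>g n \<in> {0..<int (p n)}\<close> by blast
qed

lemma per_part_cong:
  assumes "k \<in> per_part p \<eta> i n" "k mod int (p n) = l mod int (p n)"
  shows "\<eta> l = i"
proof -
  obtain j where "l = k + int (p n) * j"
    using assms(2) by (metis mod_eqE)
  then show ?thesis using assms(1) by (simp add: per_part_def)
qed

lemma V_part_disjoint: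
  assumes "toeplitz p \<eta>" shows "V_part p \<eta> i \<inter> V_part p \<eta> (\<not> i) = {}"
proof -
  have False if g: "g \<in> odometer p" "g n \<in> per_part p \<eta> i n" "g m \<in> per_part p \<eta> (\<not> i) m" for g n m
  proof -
    have *: "g (max n m) mod int (p n) = g n mod int (p n)"
            "g (max n m) mod int (p m) = g m mod int (p m)"
      using odometer_coherent[OF assms g(1)] by (metis max.cobounded1 max.cobounded2 mod_mod_trivial)+
    then have "\<eta> (g (max n m)) = i" "\<eta> (g (max n m)) = (\<not> i)"
      using per_part_cong g by metis+
    then show False by simp
  qed
  then show ?thesis using V_part_iff[OF assms] by blast
qed

lemma Delta_in_V_part:
  assumes "toeplitz p \<eta>" shows "Delta p l \<in> V_part p \<eta> (\<eta> l)"
proof -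
  obtain n where n: "\<And>j. \<eta> (l + int (p n) * j) = \<eta> l"
    using assms unfolding toeplitz_def by blast
  have "\<eta> (l mod int (p n) + int (p n) * j) = \<eta> l" for j
    using n[of "j - l div int (p n)"]
    by (metis (no_types, opaque_lifting) add.commute add_diff_eq diff_diff_eq2
        minus_mult_div_eq_mod right_diff_distrib')
  then show ?thesis
    using V_part_iff[OF assms] Delta_in_odometer[OF assms]
    by (auto simp: per_part_def Delta_def)
qed

lemma closure_V_part:
  assumes "toeplitz p \<eta>"
  shows "odometer_top p closure_of V_part p \<eta> i = odometer p - V_part p \<eta> (\<not> i)"
proof
  have "closedin (odometer_top p) (odometer p - V_part p \<eta> (\<not> i))"
    using openin_V_part[of p \<eta> "\<not> i"] by (metis openin_closedin_eq topspace_euclidean_subtopology)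
  moreover have "V_part p \<eta> i \<subseteq> odometer p - V_part p \<eta> (\<not> i)"
    using V_part_disjoint[OF assms] V_part_subset by blast
  ultimately show "odometer_top p closure_of V_part p \<eta> i \<subseteq> odometer p - V_part p \<eta> (\<not> i)"
    by (rule closure_of_minimal[rotated])
next
  show "odometer p - V_part p \<eta> (\<not> i) \<subseteq> odometer_top p closure_of V_part p \<eta> i"
  proof
    fix g assume g: "g \<in> odometer p - V_part p \<eta> (\<not> i)"
    have "\<exists>y. y \<in> V_part p \<eta> i \<and> y \<in> U" if U: "g \<in> U" "openin (odometer_top p) U" for U
    proof -
      obtain n where n: "cyl p n g \<subseteq> U"
        using openin_contains_cyl[OF assms U(2) U(1)] by blast
      have "g n \<notin> per_part p \<eta> (\<not> i) n"
        using g V_part_iff[OF assms] by blast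
      then obtain j where j: "\<eta> (g n + int (p n) * j) = i"
        by (auto simp: per_part_def)
      define l where "l = g n + int (p n) * j"
      have "Delta p l n = g n"
        using g by (simp add: Delta_def l_def odometer_def)
      then have "Delta p l \<in> cyl p n g"
        using Delta_in_odometer[OF assms] by (simp add: cyl_def)
      then show ?thesis
        using Delta_in_V_part[OF assms, of l] j n by (auto simp: l_def)
    qed
    then show "g \<in> odometer_top p closure_of V_part p \<eta> i"
      using g by (auto simp: in_closure_of)
  qed
qed

lemma W_eq:
  assumes "toeplitz p \<eta>" shows "W p \<eta> = odometer p - V_part p \<eta> False"
  using closure_V_part[OF assms, of True] by (simp add: W_def)

lemma bdW_eq:
  assumes "toeplitz p \<eta>"
  shows "bdW p \<eta> = odometer p - (V_part p \<eta> False \<union> V_part p \<eta> True)"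
proof -
  have "odometer_top p closure_of W p \<eta> = W p \<eta>"
    by (simp add: W_def)
  moreover have "topspace (odometer_top p) - W p \<eta> = V_part p \<eta> False"
    using W_eq[OF assms] V_part_subset[of p \<eta> False] by auto
  ultimately have "bdW p \<eta> = W p \<eta> \<inter> (odometer p - V_part p \<eta> True)"
    using closure_V_part[OF assms, of False] by (simp add: bdW_def frontier_of_closures)
  then show ?thesis using W_eq[OF assms] by auto
qed

end

theory Submission
  imports Defs
begin

text \<open>
  A point of \<open>bdW\<close> passes through a hole at every level, so by compactness the essential holes at
  level \<open>n\<close> are the projection of \<open>bdW\<close> to \<open>\<int>/p\<^sub>n\<close>. If translation by \<open>k \<noteq> 0\<close> mapped a nonempty relatively
  open part of \<open>bdW\<close> into \<open>bdW\<close>, it would preserve the essential holes at level \<open>n\<close> that lie in a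
  class modulo a fixed \<open>p\<^sub>N\<close>. Convergence of the sum of the \<open>1/a\<close> and primitivity force every \<open>a \<in> A n\<close> to
  divide \<open>p\<^sub>n\<close>, and then the essential holes are closed under multiplication by units modulo \<open>p\<^sub>n\<close>.
  Hence \<open>j * u + k\<close> is a multiple of some \<open>a \<in> A n\<close> for a proportion of at least \<open>1/p\<^sub>N\<close> of all units \<open>u\<close>,
  whereas the proportion of units that work for a given \<open>a\<close> is at most \<open>\<bar>k\<bar>/totient a\<close>; this is
  impossible once the sum of the \<open>1/totient a\<close> is small.

  A coordinate of a point of the orbit closure is determined by its fibre unless the corresponding
  translate of the fibre lies in \<open>bdW\<close>, where both values occur. Reading this through the block code
  of \<open>F\<close> gives for each \<open>h \<in> bdW\<close> some \<open>l \<in> [-m,m]\<close> with \<open>h - y + l \<in> bdW\<close>. For \<open>h \<in> V\<^sub>k\<close>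
  applying it to \<open>h + y - k\<close> yields \<open>h + (l - k) \<in> bdW\<close>, which for generic \<open>h\<close> forces \<open>l = k\<close>.
\<close>

section \<open>Units in residue classes\<close>

text \<open>With \<open>t\<close> the product of the primes of \<open>m\<close> that do not divide
  \<open>c\<close>, every prime factor of \<open>m\<close> divides exactly one of \<open>c\<close>
  and \<open>b * t\<close>.\<close>

lemma coprime_arith_progression_lift:
  fixes c b m :: nat
  assumes "coprime c b" "m > 0"
  shows "\<exists>t. coprime (c + b * t) m"
proof -
  define t where "t = \<Prod>{q \<in> prime_factors m. \<not> q dvd c}"
  have "coprime (c + b * t) m"
  proof (rule ccontr)
    assume "\<not> coprime (c + b * t) m"
    then obtain q where q: "prime q" "q dvd c + b * t" "q dvd m"
      by (metis coprime_iff_gcd_eq_1 gcd_nat.bounded_iff prime_factor_nat)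
    show False
    proof (cases "q dvd c")
      case True
      then have "q dvd b * t" using q(2) by (metis dvd_add_right_iff)
      moreover have "\<not> q dvd b"
        using True assms(1) q(1) by (metis coprime_common_divisor not_prime_unit)
      ultimately have "q dvd t" using q(1) by (simp add: prime_dvd_mult_iff)
      then obtain r where r: "r \<in> prime_factors m" "\<not> r dvd c" "q dvd r"
        using q(1) by (auto simp: t_def prime_dvd_prod_iff)
      then show False
        using True q(1) by (metis in_prime_factors_iff primes_dvd_imp_eq)
    next
      case False
      then have "q \<in> {q \<in> prime_factors m. \<not> q dvd c}"
        using q assms(2) by (auto simp: in_prime_factors_iff)
      then have "q dvd t" unfolding t_def by (intro dvd_prodI) auto
      then have "q dvd c" using q(2) by (metis dvd_add_left_iff dvd_mult)
      then show False using False by simp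
    qed
  qed
  then show ?thesis ..
qed

text \<open>For modulus 1 this is {0}, whereas \<open>totatives 1\<close> is {1}; so the reduction
  of a unit modulo \<open>q\<close> always lands in it.\<close>

definition units_below :: "nat \<Rightarrow> nat set" where
  "units_below q = {u. u < q \<and> coprime u q}"

lemma finite_units_below [simp]: "finite (units_below q)"
  by (simp add: units_below_def)

lemma card_units_below:
  assumes "q > 0" shows "card (units_below q) = totient q"
proof (cases "q = 1")
  case True
  then have "units_below q = {0}" by (auto simp: units_below_def)
  then show ?thesis using True by simp
next
  case False
  then have q: "q > 1" using assms by simp
  have "u \<in> units_below q \<longleftrightarrow> u \<in> totatives q" for u
  proof
    assume "u \<in> units_below q"
    then show "u \<in> totatives q"
      using q by (cases "u = 0") (auto simp: units_below_def in_totatives_iff)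
  next
    assume "u \<in> totatives q"
    then show "u \<in> units_below q"
      using q totatives_less[of u q] by (auto simp: units_below_def in_totatives_iff)
  qed
  then have "units_below q = totatives q" by blast
  then show ?thesis by (simp add: totient_def)
qed

lemma mod_in_units_below: "q > 0 \<Longrightarrow> coprime u q \<Longrightarrow> u mod q \<in> units_below q"
  by (simp add: units_below_def coprime_commute)

text \<open>Multiplication by a unit \<open>w\<close> modulo \<open>q\<close> that is congruent to
  \<open>c' / c\<close> modulo \<open>b\<close> maps the first fibre injectively into the second.
  Such a \<open>w\<close> exists because units modulo \<open>b\<close> lift to units modulo
  \<open>q\<close>.\<close>

lemma card_unit_fibre_le:
  assumes "q > 0" "b dvd q" "coprime c b" "coprime c' b"
  shows "card {u \<in> units_below q. [u = c] (mod b)} \<le> card {u \<in> units_below q. [u = c'] (mod b)}"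
proof -
  obtain x where x: "[c * x = 1] (mod b)"
    using assms(3) cong_solve_coprime_nat by fastforce
  then have xb: "coprime x b"
    by (metis coprime_1_left coprime_commute coprime_mult_right_iff cong_imp_coprime cong_sym)
  then have "coprime (x * c') b" using assms(4) by simp
  then obtain t where t: "coprime (x * c' + b * t) q"
    using coprime_arith_progression_lift assms(1) by blast
  define w where "w = x * c' + b * t"
  have w: "coprime w q" "[w = x * c'] (mod b)"
    using t by (auto simp: w_def cong_def)
  show ?thesis
  proof (rule card_inj_on_le)
    show "inj_on (\<lambda>u. u * w mod q) {u \<in> units_below q. [u = c] (mod b)}"
    proof (rule inj_onI)
      fix u v assume uv: "u \<in> {u \<in> units_below q. [u = c] (mod b)}"
        "v \<in> {u \<in> units_below q. [u = c] (mod b)}" "u * w mod q = v * w mod q"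
      then have "[u * w = v * w] (mod q)" by (simp add: cong_def)
      then have "[u = v] (mod q)"
        using w(1) cong_mult_rcancel_nat by blast
      then show "u = v"
        using uv by (auto simp: units_below_def cong_less_modulus_unique_nat)
    qed
    show "(\<lambda>u. u * w mod q) ` {u \<in> units_below q. [u = c] (mod b)}
        \<subseteq> {u \<in> units_below q. [u = c'] (mod b)}"
    proof clarify
      fix u assume u: "u \<in> units_below q" "[u = c] (mod b)"
      have "coprime (u * w) q" using u w by (simp add: units_below_def)
      then have 1: "u * w mod q \<in> units_below q"
        using assms(1) mod_in_units_below by blast
      have "[u * w mod q = u * w] (mod b)"
        using assms(2) by (simp add: cong_def mod_mod_cancel)
      also have "[u * w = c * (x * c')] (mod b)"
        using u w cong_mult by blast
      also have "c * (x * c') = (c * x) * c'" by simp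
      also have "[(c * x) * c' = 1 * c'] (mod b)"
        using x cong_mult cong_refl by blast
      finally show "u * w mod q \<in> units_below q \<and> [u * w mod q = c'] (mod b)"
        using 1 by simp
    qed
  qed simp
qed

text \<open>By the preceding inequality in both directions, all fibres of the reduction from units
  modulo \<open>q\<close> to units modulo \<open>b\<close> have the same size.\<close>

lemma card_unit_fibre:
  assumes "q > 0" "b dvd q" "coprime c b"
  shows "card {u \<in> units_below q. [u = c] (mod b)} * totient b = totient q"
proof -
  have b: "b > 0" using assms(1,2) by (auto intro: Nat.gr0I)
  have im: "(\<lambda>u. u mod b) ` units_below q \<subseteq> units_below b"
    using assms(2) b mod_in_units_below
    by (auto simp: units_below_def coprime_divisors[OF dvd_refl])
  have "totient q = (\<Sum>d\<in>units_below b. card {u \<in> units_below q. u mod b = d})"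
    using sum.group[OF _ _ im, of "\<lambda>_. 1::nat"] card_units_below[OF assms(1)] by simp
  also have "\<dots> = (\<Sum>d\<in>units_below b. card {u \<in> units_below q. [u = c] (mod b)})"
  proof (rule sum.cong)
    fix d assume d: "d \<in> units_below b"
    then have "{u \<in> units_below q. u mod b = d} = {u \<in> units_below q. [u = d] (mod b)}"
      by (auto simp: units_below_def cong_def)
    then show "card {u \<in> units_below q. u mod b = d} = card {u \<in> units_below q. [u = c] (mod b)}"
      using d assms card_unit_fibre_le[of q b d c] card_unit_fibre_le[of q b c d]
      by (simp add: units_below_def)
  qed simp
  also have "\<dots> = card {u \<in> units_below q. [u = c] (mod b)} * totient b"
    using card_units_below[OF b] by simp
  finally show ?thesis by simp
qed

lemma card_cong_class:
  fixes b e c :: nat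
  assumes "b > 0"
  shows "card {u. u < b * e \<and> [u = c] (mod b)} \<le> e"
proof -
  have "card {u. u < b * e \<and> [u = c] (mod b)} \<le> card {..<e}"
  proof (rule card_inj_on_le)
    show "inj_on (\<lambda>u. u div b) {u. u < b * e \<and> [u = c] (mod b)}"
      by (rule inj_onI) (metis (mono_tags, lifting) cong_def div_mult_mod_eq mem_Collect_eq)
    show "(\<lambda>u. u div b) ` {u. u < b * e \<and> [u = c] (mod b)} \<subseteq> {..<e}"
      using assms by (auto simp: less_mult_imp_div_less mult.commute)
  qed simp
  then show ?thesis by simp
qed

text \<open>The fibre over 1 of the reduction from units modulo \<open>b * e\<close> to units modulo
  \<open>b\<close> lies in a residue class with at most \<open>e\<close> representatives.\<close>

lemma totient_mult_le:
  fixes b e :: nat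
  assumes "b > 0" "e > 0"
  shows "totient (b * e) \<le> e * totient b"
proof -
  have "card {u \<in> units_below (b * e). [u = 1] (mod b)} \<le> card {u. u < b * e \<and> [u = 1] (mod b)}"
    by (rule card_mono) (auto simp: units_below_def)
  also have "\<dots> \<le> e" using card_cong_class assms(1) .
  finally have "card {u \<in> units_below (b * e). [u = 1] (mod b)} * totient b \<le> e * totient b"
    by simp
  then show ?thesis using card_unit_fibre[of "b * e" b 1] assms by (simp del: One_nat_def)
qed

section \<open>Progressions covered by sets of multiples\<close>

text \<open>After division by \<open>gcd a d\<close>, the quotient \<open>b\<close> must divide
  \<open>v + m * s\<close>, which is coprime to \<open>m\<close>. So \<open>m\<close> is invertible
  modulo \<open>b\<close> and all solutions \<open>s\<close> are congruent modulo \<open>b\<close>;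
  the summand 1 accounts for an incomplete last block.\<close>

lemma card_multiples_in_progression:
  fixes a d v m X :: nat
  assumes "a > 0" "d > 0" "coprime v m"
  shows "real (card {s. s < X \<and> a dvd d * (v + m * s)}) \<le> real d * real X / real a + 1"
proof -
  define b where "b = a div gcd a d"
  have ab: "a = b * gcd a d" by (simp add: b_def)
  have g: "gcd a d > 0" using assms by simp
  have b: "b > 0" using ab assms(1) by (metis gr0I mult_0)
  have cop: "coprime b (d div gcd a d)"
    using assms by (simp add: b_def div_gcd_coprime)
  have bd: "b dvd w" if "a dvd d * w" for w
  proof -
    have "gcd a d * b dvd gcd a d * ((d div gcd a d) * w)"
      using that ab by (metis dvd_mult_div_cancel gcd_dvd2 mult.assoc mult.commute)
    then have "b dvd (d div gcd a d) * w" using g by (metis dvd_times_left_cancel_iff less_numeral_extra(3))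
    then show ?thesis using cop coprime_dvd_mult_right_iff by blast
  qed
  have "card {s. s < X \<and> a dvd d * (v + m * s)} \<le> card {..X div b}"
  proof (rule card_inj_on_le)
    show "inj_on (\<lambda>s. s div b) {s. s < X \<and> a dvd d * (v + m * s)}"
    proof (rule inj_onI)
      fix s s' assume s: "s \<in> {s. s < X \<and> a dvd d * (v + m * s)}"
        "s' \<in> {s. s < X \<and> a dvd d * (v + m * s)}" "s div b = s' div b"
      have dv: "b dvd v + m * s" "b dvd v + m * s'" using s bd by auto
      have "coprime (v + m * s) m" using assms(3)
        by (metis coprime_iff_gcd_eq_1 gcd.commute gcd_add_mult mult.commute add.commute)
      then have "coprime m b" using dv(1) by (meson coprime_commute coprime_divisors dvd_refl)
      moreover have "[v + m * s = v + m * s'] (mod b)"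
        using dv by (simp add: cong_def mod_eq_0_iff_dvd)
      ultimately have "[s = s'] (mod b)"
        using cong_add_lcancel_nat cong_mult_lcancel_nat by blast
      then show "s = s'" using s(3) by (metis cong_def div_mult_mod_eq)
    qed
  qed (auto intro: div_le_mono)
  also have "\<dots> = X div b + 1" by simp
  finally have "real (card {s. s < X \<and> a dvd d * (v + m * s)}) \<le> real (X div b) + 1"
    by (metis of_nat_1 of_nat_add of_nat_le_iff)
  moreover have "real (X div b) \<le> real X / real b" by (rule of_nat_div_le_of_nat)
  moreover have "real X / real b \<le> real d * real X / real a"
  proof -
    have "real X / real b = real (gcd a d) * real X / real a"
      using g by (subst (2) ab) simp
    also have "\<dots> \<le> real d * real X / real a"
      using assms by (intro divide_right_mono mult_right_mono) simp_all
    finally show ?thesis .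
  qed
  ultimately show ?thesis by linarith
qed

lemma summable_on_finite_tail:
  fixes f :: "'a \<Rightarrow> real"
  assumes "f summable_on A" "\<And>a. a \<in> A \<Longrightarrow> f a \<ge> 0" "\<epsilon> > 0"
  obtains F0 where "finite F0" "F0 \<subseteq> A"
    "\<And>F. finite F \<Longrightarrow> F \<subseteq> A - F0 \<Longrightarrow> sum f F \<le> \<epsilon>"
proof -
  obtain F0 where F0: "finite F0" "F0 \<subseteq> A" "dist (sum f F0) (infsum f A) \<le> \<epsilon>"
    using infsum_finite_approximation[OF assms(1,3)] by blast
  have "sum f F \<le> \<epsilon>" if F: "finite F" "F \<subseteq> A - F0" for F
  proof -
    have "sum f F0 + sum f F = sum f (F0 \<union> F)"
      using F F0 by (subst sum.union_disjoint) auto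
    also have "\<dots> \<le> infsum f A"
      using F F0 assms by (intro finite_sum_le_infsum) auto
    finally show ?thesis using F0(3) by (simp add: dist_real_def)
  qed
  then show ?thesis using that F0 by blast
qed

text \<open>If no element of \<open>A\<close> divides both \<open>c\<close> and \<open>q\<close>, a
  subprogression avoids all multiples of elements of a finite \<open>A0\<close> outside of which the
  sum of the \<open>1 / a\<close> is tiny. The remaining divisors are too sparse to cover that
  subprogression.\<close>

lemma progression_multiples_imp_divisor:
  fixes A :: "nat set" and c q :: nat
  assumes A: "0 \<notin> A" "(\<lambda>a. 1 / real a) summable_on A" and c: "c > 0" and q: "q > 0"
    and cover: "\<And>t. \<exists>a\<in>A. a dvd c + q * t"
  shows "\<exists>a\<in>A. a dvd c \<and> a dvd q"
proof (rule ccontr)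
  assume no: "\<not> ?thesis"
  define d where "d = gcd c q"
  have d: "d > 0" using q by (simp add: d_def)
  obtain A0 where A0: "finite A0" "A0 \<subseteq> A"
    "\<And>F. finite F \<Longrightarrow> F \<subseteq> A - A0 \<Longrightarrow> (\<Sum>a\<in>F. 1 / real a) \<le> 1 / (4 * real d)"
    using summable_on_finite_tail[OF A(2), of "1 / (4 * real d)"] d by auto
  define L where "L = \<Prod>A0"
  have L: "L > 0" using A0 A(1) unfolding L_def by (metis gr0I prod_zero_iff subset_iff)
  define c1 q1 where "c1 = c div d" and "q1 = q div d"
  have cq: "c = d * c1" "q = d * q1" by (simp_all add: c1_def q1_def d_def)
  have q1: "q1 > 0" using cq(2) q by (metis gr0I mult_0_right)
  have "coprime c1 q1" using q by (simp add: c1_def q1_def d_def div_gcd_coprime)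
  \<comment> \<open>Coprimality to \<open>L\<close> disposes of \<open>A0\<close>: an element of
    \<open>A0\<close> dividing a term would be coprime to the second factor, hence divide
    \<open>d\<close> and so both \<open>c\<close> and \<open>q\<close>.\<close>
  then obtain t0 where t0: "coprime (c1 + q1 * t0) (L * q1)"
    using coprime_arith_progression_lift[of c1 q1 "L * q1"] L q1 by auto
  define v m M where "v = c1 + q1 * t0" and "m = L * q1" and "M = v + m"
  have vm: "coprime v m" using t0 by (simp add: v_def m_def)
  have M: "M > 0" using L q1 by (simp add: M_def m_def)
  \<comment> \<open>The rounding terms 1 in \<open>card_multiples_in_progression\<close> add up to
    the number of divisors in play; this second tail bounds that number.\<close>
  obtain A2 where A2: "finite A2" "A2 \<subseteq> A"
    "\<And>F. finite F \<Longrightarrow> F \<subseteq> A - A2 \<Longrightarrow> (\<Sum>a\<in>F. 1 / real a) \<le> 1 / (4 * real d * real M)"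
    using summable_on_finite_tail[OF A(2), of "1 / (4 * real d * real M)"] d M by auto
  \<comment> \<open>Covering \<open>X\<close> terms will require
    \<open>X \<le> X / 4 + (card A2 + X / 4)\<close>, which fails for this \<open>X\<close>.\<close>
  define X where "X = 4 * card A2 + 1"
  \<comment> \<open>All terms with \<open>s < X\<close> are positive and at most
    \<open>d * M * X\<close>, so only divisors up to this bound occur and \<open>B\<close> is
    finite.\<close>
  define B where "B = {a \<in> A - A0. a \<le> d * M * X}"
  have B: "finite B" "B \<subseteq> A - A0" by (auto simp: B_def)
  have "\<exists>a\<in>B. a dvd d * (v + m * s)" if s: "s < X" for s
  proof -
    have eq: "d * (v + m * s) = c + q * (t0 + L * s)"
      by (simp add: cq v_def m_def algebra_simps)
    then obtain a where a: "a \<in> A" "a dvd d * (v + m * s)" using cover by metis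
    have cop: "coprime (v + m * s) m" using vm
      by (metis coprime_iff_gcd_eq_1 gcd.commute gcd_add_mult mult.commute add.commute)
    have "a \<notin> A0"
    proof
      assume "a \<in> A0"
      then have "a dvd L" using A0 using dvd_prodI[of A0 a "\<lambda>x. x"] by (simp add: L_def)
      then have "coprime a (v + m * s)"
        using cop by (metis coprime_commute coprime_divisors dvd_mult2 dvd_refl m_def)
      then have "a dvd d" using a(2) coprime_dvd_mult_left_iff by blast
      then show False using no a(1) by (auto simp: d_def)
    qed
    moreover have "a \<le> d * M * X"
    proof -
      have "v > 0" using c cq(1) by (cases "c1 = 0") (auto simp: v_def)
      then have "a \<le> d * (v + m * s)" using a(2) d by (intro dvd_imp_le) auto
      also have "v + m * s \<le> v * X + m * X" using s by (intro add_mono mult_left_mono) auto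
      also have "d * (v * X + m * X) = d * M * X" by (simp add: M_def algebra_simps)
      finally show ?thesis by simp
    qed
    ultimately show ?thesis using a by (auto simp: B_def)
  qed
  then have "{..<X} \<subseteq> (\<Union>a\<in>B. {s. s < X \<and> a dvd d * (v + m * s)})" by auto
  then have "card {..<X} \<le> card (\<Union>a\<in>B. {s. s < X \<and> a dvd d * (v + m * s)})"
    using B(1) by (intro card_mono) auto
  also have "\<dots> \<le> (\<Sum>a\<in>B. card {s. s < X \<and> a dvd d * (v + m * s)})"
    by (rule card_UN_le) (rule B(1))
  finally have "X \<le> (\<Sum>a\<in>B. card {s. s < X \<and> a dvd d * (v + m * s)})" by simp
  then have "real X \<le> real (\<Sum>a\<in>B. card {s. s < X \<and> a dvd d * (v + m * s)})"
    by (rule of_nat_mono)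
  also have "\<dots> = (\<Sum>a\<in>B. real (card {s. s < X \<and> a dvd d * (v + m * s)}))"
    by (rule of_nat_sum)
  also have "\<dots> \<le> (\<Sum>a\<in>B. real d * real X * (1 / real a) + 1)"
  proof (rule sum_mono)
    fix a assume "a \<in> B"
    then have "a > 0" using A(1) by (auto simp: B_def intro: Nat.gr0I)
    then show "real (card {s. s < X \<and> a dvd d * (v + m * s)}) \<le> real d * real X * (1 / real a) + 1"
      using card_multiples_in_progression[OF _ d vm, of a X] by simp
  qed
  also have "\<dots> = real d * real X * (\<Sum>a\<in>B. 1 / real a) + real (card B)"
    by (simp only: sum.distrib sum_distrib_left[symmetric]) simp
  also have "\<dots> \<le> real d * real X * (1 / (4 * real d)) + real (card B)"
    using A0(3)[OF B] by (intro add_mono mult_left_mono) auto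
  also have "\<dots> = real X / 4 + real (card B)" using d by simp
  finally have 1: "real X \<le> real X / 4 + real (card B)" .
  have "card B \<le> card (A2 \<union> (B - A2))" using A2(1) B(1) by (intro card_mono) auto
  also have "\<dots> \<le> card A2 + card (B - A2)" by (rule card_Un_le)
  finally have 2: "real (card B) \<le> real (card A2) + real (card (B - A2))" by linarith
  have "real (card (B - A2)) = (\<Sum>a\<in>B - A2. 1)" by simp
  \<comment> \<open>Each such \<open>a\<close> is at most \<open>d * M * X\<close>, so weighting it
    by \<open>d * M * X / a\<close> can only increase the count.\<close>
  also have "\<dots> \<le> (\<Sum>a\<in>B - A2. real d * real M * real X * (1 / real a))"
  proof (rule sum_mono)
    fix a assume "a \<in> B - A2"
    then have "a > 0" "a \<le> d * M * X" using A(1) by (auto simp: B_def intro: Nat.gr0I)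
    then have "real a \<le> real d * real M * real X" by (metis of_nat_le_iff of_nat_mult)
    then show "1 \<le> real d * real M * real X * (1 / real a)" using \<open>a > 0\<close> by simp
  qed
  also have "\<dots> = real d * real M * real X * (\<Sum>a\<in>B - A2. 1 / real a)"
    by (simp only: sum_distrib_left)
  also have "\<dots> \<le> real d * real M * real X * (1 / (4 * real d * real M))"
    using A2(3)[of "B - A2"] B by (intro mult_left_mono) auto
  also have "\<dots> = real X / 4" using d M by simp
  finally have "real (card (B - A2)) \<le> real X / 4" .
  moreover have "real X = 4 * real (card A2) + 1" by (simp add: X_def)
  ultimately show False using 1 2 of_nat_0_le_iff[of "card A2", where 'a = real] by linarith
qed

text \<open>A solution forces \<open>e\<close>, the gcd of \<open>a\<close> and \<open>j\<close>, to
  divide \<open>k\<close>, so \<open>e\<close> is at most the absolute value of \<open>k\<close>.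
  All solutions agree modulo \<open>b = a / e\<close>, hence lie in one fibre of size
  \<open>totient q / totient b\<close>, and \<open>totient a \<le> e * totient b\<close>.\<close>

lemma card_units_affine_le:
  fixes a q :: nat and j k :: int
  assumes "q > 0" "a dvd q" "k \<noteq> 0"
  shows "card {u \<in> units_below q. int a dvd j * int u + k} * totient a \<le> nat \<bar>k\<bar> * totient q"
proof (cases "{u \<in> units_below q. int a dvd j * int u + k} = {}")
  case True
  show ?thesis unfolding True by simp
next
  case False
  then obtain u0 where u0: "u0 \<in> units_below q" "int a dvd j * int u0 + k" by blast
  have a: "a > 0" using assms(1,2) by (auto intro: Nat.gr0I)
  define e b where "e = gcd a (nat \<bar>j\<bar>)" and "b = a div e"
  have e: "e > 0" "e dvd a" "int e dvd j" using a by (simp_all add: e_def nat_dvd_iff flip: int_dvd_int_iff)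
  have ab: "a = b * e" using e(2) by (simp add: b_def)
  have b: "b > 0" "b dvd q" using ab a assms(2) by (auto intro: Nat.gr0I dvd_trans)
  have "int e dvd j * int u0 + k" using u0(2) e(2) by (meson dvd_trans int_dvd_int_iff)
  then have "int e dvd k" using e(3) by (metis dvd_add_right_iff dvd_mult2)
  then have ek: "e \<le> nat \<bar>k\<bar>" using assms(3) by (metis dvd_imp_le_int nat_int nat_mono abs_of_nat)
  obtain r where r: "j = int e * r" using e(3) by (elim dvdE)
  have cop: "coprime (int b) r"
  proof -
    have "gcd (int a) j = int e" by (simp only: e_def gcd_int_def abs_of_nat nat_int)
    then have "coprime (int a div int e) (j div int e)"
      using div_gcd_coprime[of "int a" j] a by simp
    then show ?thesis using r e(1) by (simp add: b_def zdiv_int)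
  qed
  have sub: "{u \<in> units_below q. int a dvd j * int u + k} \<subseteq> {u \<in> units_below q. [u = u0] (mod b)}"
  proof
    fix u assume "u \<in> {u \<in> units_below q. int a dvd j * int u + k}"
    then have u: "u \<in> units_below q" "int a dvd j * int u + k" by simp_all
    then have "int a dvd (j * int u + k) - (j * int u0 + k)" using u0(2) dvd_diff by blast
    then have "int e * int b dvd int e * (r * (int u - int u0))"
      by (simp add: r ab algebra_simps)
    then have "int b dvd r * (int u - int u0)"
      using e(1) by (subst (asm) dvd_mult_cancel_left) simp
    then have "int b dvd int u - int u0" using cop coprime_dvd_mult_right_iff by blast
    then show "u \<in> {u \<in> units_below q. [u = u0] (mod b)}"
      using u(1) by (simp add: cong_iff_dvd_diff flip: cong_int_iff)
  qed
  have "coprime u0 b" using u0(1) b(2) by (auto simp: units_below_def intro: coprime_divisors)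
  then have fib: "card {u \<in> units_below q. [u = u0] (mod b)} * totient b = totient q"
    using card_unit_fibre assms(1) b(2) by blast
  have "card {u \<in> units_below q. int a dvd j * int u + k} * totient a
      \<le> card {u \<in> units_below q. [u = u0] (mod b)} * (e * totient b)"
    using card_mono[OF _ sub] totient_mult_le[OF b(1) e(1)] by (intro mult_le_mono) (simp_all add: ab)
  also have "\<dots> = e * totient q" using fib by (simp add: mult.left_commute)
  also have "\<dots> \<le> nat \<bar>k\<bar> * totient q" using ek by simp
  finally show ?thesis .
qed

section \<open>Periodic sets assembled from multiples of a primitive set\<close>

lemma dvd_period_of_primitive_cover:
  fixes A :: "nat set" and S :: "nat \<Rightarrow> nat set" and q :: nat
  assumes E: "E = (\<Union>a\<in>A. {k. int a dvd k} - multiples (S a))"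
    and per: "\<And>k j. k \<in> E \<Longrightarrow> k + int q * j \<in> E"
    and A: "0 \<notin> A" "primitive_set A" "(\<lambda>a. 1 / real a) summable_on A"
    and ne: "\<And>a. a \<in> A \<Longrightarrow> {k. int a dvd k} - multiples (S a) \<noteq> {}"
    and q: "q > 0" and a: "a \<in> A"
  shows "a dvd q"
proof -
  obtain x where x: "int a dvd x" "x \<notin> multiples (S a)" using ne[OF a] by blast
  \<comment> \<open>An \<open>s\<close> in \<open>S a\<close> dividing \<open>a\<close> would divide
    every multiple of \<open>a\<close> and so empty the piece belonging to \<open>a\<close>.\<close>
  have "int a \<notin> multiples (S a)"
    using x by (auto simp: multiples_def simp del: int_dvd_int_iff intro: dvd_trans)
  then have aE: "int a \<in> E" using a unfolding E by fastforce
  have "\<exists>a'\<in>A. a' dvd a + q * t" for t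
  proof -
    have "int a + int q * int t \<in> E" using per aE by blast
    then obtain a' where "a' \<in> A" "int a' dvd int a + int q * int t" by (auto simp: E)
    then show ?thesis by (metis int_dvd_int_iff of_nat_add of_nat_mult)
  qed
  moreover have "a > 0" using a A(1) by (auto intro: Nat.gr0I)
  \<comment> \<open>The progression \<open>a + q * t\<close> stays in \<open>E\<close>, so it is
    covered by multiples of elements of \<open>A\<close>. Primitivity then identifies the common
    divisor \<open>a'\<close> of \<open>a\<close> and \<open>q\<close> with
    \<open>a\<close>.\<close>
  ultimately obtain a' where "a' \<in> A" "a' dvd a" "a' dvd q"
    using progression_multiples_imp_divisor[OF A(1,3) _ q] by blast
  then show ?thesis using A(2) a by (auto simp: primitive_set_def)
qed

lemma unit_power_cong_1:
  fixes u q :: nat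
  assumes "q > 0" "coprime u q"
  shows "\<exists>e>0. [u ^ e = 1] (mod q)"
proof -
  have "range (\<lambda>n. u ^ n mod q) \<subseteq> {..<q}" using assms(1) by auto
  then have "finite (range (\<lambda>n. u ^ n mod q))" using finite_subset by blast
  then have "\<not> inj (\<lambda>n. u ^ n mod q)" using finite_imageD by auto
  then obtain i j where "i < j" "u ^ i mod q = u ^ j mod q"
    by (metis (no_types, lifting) injI linorder_neqE_nat)
  then have "[u ^ i * u ^ (j - i) = u ^ i * 1] (mod q)"
    by (simp add: cong_def flip: power_add)
  moreover have "coprime (u ^ i) q" using assms(2) by simp
  ultimately have "[u ^ (j - i) = 1] (mod q)" using cong_mult_lcancel_nat by blast
  then show ?thesis using \<open>i < j\<close> by (intro exI[of _ "j - i"]) simp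
qed

text \<open>Since \<open>u ^ e\<close> is 1 modulo \<open>q\<close> for some \<open>e > 0\<close>,
  the number \<open>j * u ^ e\<close> lies in some piece of \<open>E\<close>. The same piece
  contains \<open>j * u\<close>: its \<open>a\<close> divides \<open>q\<close>, so it is coprime to
  \<open>u\<close> and divides \<open>j\<close>, while an \<open>s\<close> dividing
  \<open>j * u\<close> would divide \<open>j * u ^ e\<close>.\<close>

lemma unit_mult_closed:
  fixes A :: "nat set" and S :: "nat \<Rightarrow> nat set" and q u :: nat
  assumes E: "E = (\<Union>a\<in>A. {k. int a dvd k} - multiples (S a))"
    and per: "\<And>k j. k \<in> E \<Longrightarrow> k + int q * j \<in> E"
    and dvd: "\<And>a. a \<in> A \<Longrightarrow> a dvd q"
    and q: "q > 0" and u: "coprime u q" and j: "j \<in> E"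
  shows "j * int u \<in> E"
proof -
  obtain e where e: "e > 0" "[u ^ e = 1] (mod q)" using unit_power_cong_1[OF q u] by blast
  from e(2) have "[int u ^ e = 1] (mod int q)" by (metis cong_int_iff of_nat_1 of_nat_power)
  then obtain i where "int u ^ e = 1 + int q * i"
    by (metis cong_iff_lin cong_sym)
  then have "j * int u ^ e = j + int q * (j * i)" by (simp add: algebra_simps)
  then have "j * int u ^ e \<in> E" using per j by simp
  then obtain a where a: "a \<in> A" "int a dvd j * int u ^ e" "j * int u ^ e \<notin> multiples (S a)"
    by (auto simp: E)
  have "coprime (int a) (int u ^ e)"
    using u dvd[OF a(1)] by (metis coprime_commute coprime_divisors coprime_int_iff coprime_power_right_iff dvd_refl)
  then have "int a dvd j" using a(2) coprime_dvd_mult_left_iff by blast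
  moreover have "j * int u \<notin> multiples (S a)"
  proof
    assume "j * int u \<in> multiples (S a)"
    then obtain s where s: "s \<in> S a" "int s dvd j * int u" by (auto simp: multiples_def)
    have "int u dvd int u ^ e" using e(1) by simp
    then have "int s dvd j * int u ^ e" using s(2) by (meson dvd_trans mult_dvd_mono dvd_refl)
    then show False using a(3) s(1) by (auto simp: multiples_def)
  qed
  ultimately show ?thesis using a(1) unfolding E by fastforce
qed

text \<open>For units \<open>u\<close> congruent to 1 modulo \<open>m\<close>, \<open>j * u\<close>
  stays in \<open>E\<close> and in the class of \<open>j\<close>, so some \<open>a\<close> divides
  \<open>j * u + k\<close>. These units have proportion \<open>1 / totient m\<close>, which is at
  least \<open>1 / m\<close>, and each \<open>a\<close> serves a proportion of at most
  \<open>\<bar>k\<bar> / totient a\<close>.\<close>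

lemma translation_invariance_bound:
  fixes A :: "nat set" and S :: "nat \<Rightarrow> nat set" and q m :: nat
  assumes E: "E = (\<Union>a\<in>A. {k. int a dvd k} - multiples (S a))"
    and per: "\<And>k j. k \<in> E \<Longrightarrow> k + int q * j \<in> E"
    and A: "0 \<notin> A" "primitive_set A" "(\<lambda>a. 1 / real a) summable_on A"
    and ne: "\<And>a. a \<in> A \<Longrightarrow> {k. int a dvd k} - multiples (S a) \<noteq> {}"
    and q: "q > 0" and m: "m dvd q" and k: "k \<noteq> 0" and j: "j \<in> E"
    and tr: "\<And>x. x \<in> E \<Longrightarrow> [x = j] (mod int m) \<Longrightarrow> x + k \<in> E"
  shows "finite A" "1 \<le> real m * real_of_int \<bar>k\<bar> * (\<Sum>a\<in>A. 1 / real (totient a))"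
proof -
  have dvd: "a dvd q" if "a \<in> A" for a
    using dvd_period_of_primitive_cover[OF E per A ne q that] by blast
  have "A \<subseteq> {..q}" using dvd q dvd_imp_le by auto
  then show fin: "finite A" using finite_subset by blast
  have m0: "m > 0" using m q by (auto intro: Nat.gr0I)
  define U where "U = {u \<in> units_below q. [u = 1] (mod m)}"
  have "U \<subseteq> (\<Union>a\<in>A. {u \<in> units_below q. int a dvd j * int u + k})"
  proof
    fix u assume u: "u \<in> U"
    then have "coprime u q" "[int u = 1] (mod int m)"
      by (auto simp: U_def units_below_def simp flip: cong_int_iff)
    then have "j * int u \<in> E" "[j * int u = j * 1] (mod int m)"
      using unit_mult_closed[OF E per dvd q _ j] cong_mult cong_refl by blast+
    then have "j * int u + k \<in> E" using tr by simp
    then show "u \<in> (\<Union>a\<in>A. {u \<in> units_below q. int a dvd j * int u + k})"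
      using u by (auto simp: E U_def)
  qed
  then have "card U \<le> card (\<Union>a\<in>A. {u \<in> units_below q. int a dvd j * int u + k})"
    using fin by (intro card_mono) auto
  also have "\<dots> \<le> (\<Sum>a\<in>A. card {u \<in> units_below q. int a dvd j * int u + k})"
    by (rule card_UN_le) (rule fin)
  finally have "real (card U) \<le> real (\<Sum>a\<in>A. card {u \<in> units_below q. int a dvd j * int u + k})"
    by (rule of_nat_mono)
  also have "\<dots> = (\<Sum>a\<in>A. real (card {u \<in> units_below q. int a dvd j * int u + k}))"
    by (rule of_nat_sum)
  also have "\<dots> \<le> (\<Sum>a\<in>A. real_of_int \<bar>k\<bar> * real (totient q) * (1 / real (totient a)))"
  proof (rule sum_mono)
    fix a assume a: "a \<in> A"
    then have "totient a > 0" using A(1) by (auto intro: Nat.gr0I)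
    moreover have "real (card {u \<in> units_below q. int a dvd j * int u + k} * totient a)
        \<le> real (nat \<bar>k\<bar> * totient q)"
      using card_units_affine_le[OF q dvd[OF a] k] of_nat_le_iff by blast
    ultimately show "real (card {u \<in> units_below q. int a dvd j * int u + k})
        \<le> real_of_int \<bar>k\<bar> * real (totient q) * (1 / real (totient a))"
      by (simp add: field_simps)
  qed
  also have "\<dots> = real_of_int \<bar>k\<bar> * real (totient q) * (\<Sum>a\<in>A. 1 / real (totient a))"
    by (simp only: sum_distrib_left)
  finally have *: "real (card U) \<le> real_of_int \<bar>k\<bar> * real (totient q) * (\<Sum>a\<in>A. 1 / real (totient a))" .
  have "totient q = card U * totient m"
    using card_unit_fibre[OF q m, of 1] by (simp add: U_def)
  also have "\<dots> \<le> card U * m" by (simp add: totient_le)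
  finally have "real (totient q) \<le> real (card U) * real m"
    by (metis of_nat_le_iff of_nat_mult)
  also have "\<dots> \<le> (real_of_int \<bar>k\<bar> * real (totient q) * (\<Sum>a\<in>A. 1 / real (totient a))) * real m"
    using * by (intro mult_right_mono) auto
  finally have "real (totient q) * 1
      \<le> real (totient q) * (real m * real_of_int \<bar>k\<bar> * (\<Sum>a\<in>A. 1 / real (totient a)))"
    by (simp add: mult_ac)
  then show "1 \<le> real m * real_of_int \<bar>k\<bar> * (\<Sum>a\<in>A. 1 / real (totient a))"
    using q by (subst (asm) mult_le_cancel_left_pos) auto
qed

section \<open>Essential holes and the boundary\<close>

lemma bdW_iff:
  assumes "toeplitz p \<eta>"
  shows "g \<in> bdW p \<eta> \<longleftrightarrow> g \<in> odometer p \<and> (\<forall>n. g n \<in> holes p \<eta> n)"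
  using V_part_iff[OF assms] by (auto simp: bdW_eq[OF assms] holes_def)

lemma bdW_subset: "toeplitz p \<eta> \<Longrightarrow> bdW p \<eta> \<subseteq> odometer p"
  by (simp add: bdW_eq)

lemma closedin_bdW: "closedin (odometer_top p) (bdW p \<eta>)"
  by (simp add: bdW_def closedin_frontier_of)

lemma per_part_periodic:
  "[k = l] (mod int (p n)) \<Longrightarrow> k \<in> per_part p \<eta> i n \<longleftrightarrow> l \<in> per_part p \<eta> i n"
proof -
  have *: "l \<in> per_part p \<eta> i n" if kl: "[k = l] (mod int (p n))" "k \<in> per_part p \<eta> i n" for k l
  proof -
    obtain t where t: "l = k + int (p n) * t"
      using kl(1) unfolding cong_iff_lin by blast
    have "\<eta> (l + int (p n) * j) = i" for j
    proof -
      have "l + int (p n) * j = k + int (p n) * (t + j)" by (simp add: t algebra_simps)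
      then show ?thesis using kl(2) by (simp add: per_part_def)
    qed
    then show ?thesis by (simp add: per_part_def)
  qed
  show "[k = l] (mod int (p n)) \<Longrightarrow> k \<in> per_part p \<eta> i n \<longleftrightarrow> l \<in> per_part p \<eta> i n"
    using * cong_sym by blast
qed

lemma holes_periodic:
  "[k = l] (mod int (p n)) \<Longrightarrow> k \<in> holes p \<eta> n \<longleftrightarrow> l \<in> holes p \<eta> n"
  using per_part_periodic[where p = p and n = n] by (simp add: holes_def)

lemma holes_antimono:
  assumes "toeplitz p \<eta>" "n \<le> m" shows "holes p \<eta> m \<subseteq> holes p \<eta> n"
proof -
  have "per_part p \<eta> i n \<subseteq> per_part p \<eta> i m" for i
  proof
    fix k assume k: "k \<in> per_part p \<eta> i n"
    obtain r where r: "p m = p n * r" using toeplitz_dvd[OF assms] by (elim dvdE)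
    have "\<eta> (k + int (p m) * j) = i" for j
      using k by (simp add: per_part_def r mult.assoc)
    then show "k \<in> per_part p \<eta> i m" by (simp add: per_part_def)
  qed
  then show ?thesis by (auto simp: holes_def)
qed

lemma odometer_cong:
  assumes "toeplitz p \<eta>" "g \<in> odometer p" "n \<le> m"
  shows "[g m = g n] (mod int (p n))"
  using odometer_coherent[OF assms] odometer_coherent[OF assms(1,2) order_refl[of n]]
  by (simp add: cong_def)

lemma Delta_coordinate_cong: "[Delta p k n = k] (mod int (p n))"
  by (simp add: Delta_def cong_def)

lemma closedin_coordinate: "closedin (odometer_top p) {g \<in> odometer p. P (g n)}"
proof -
  have "open ((\<lambda>g :: nat \<Rightarrow> int. g n) -` (- {x. P x}))"
    by (rule open_vimage) (auto simp: open_discrete intro!: continuous_on_product_coordinates)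
  then have "closed ((\<lambda>g :: nat \<Rightarrow> int. g n) -` {x. P x})"
    by (simp only: closed_def vimage_Compl)
  moreover have "{g \<in> odometer p. P (g n)} = odometer p \<inter> (\<lambda>g. g n) -` {x. P x}" by auto
  ultimately show ?thesis by (metis closedin_closed_Int)
qed

lemma decreasing_closed_nonempty:
  fixes C :: "nat \<Rightarrow> 'a set"
  assumes "compact_space X" "\<And>n. closedin X (C n)" "\<And>n. C n \<noteq> {}" "\<And>n m. n \<le> m \<Longrightarrow> C m \<subseteq> C n"
  shows "(\<Inter>n. C n) \<noteq> {}"
  using compact_space_imp_nest[OF assms(1), of C] assms(2-4) by (auto simp: decseq_def)

text \<open>Requiring a hole at level \<open>n + i\<close> above the class of \<open>k\<close> gives
  decreasing closed sets of odometer points, each containing \<open>Delta\<close> of an actual hole.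
  By compactness they have a common point, which runs through holes at all levels.\<close>

lemma essential_holes_iff:
  assumes T: "toeplitz p \<eta>" and c: "compact_space (odometer_top p)"
  shows "k \<in> essential_holes p \<eta> n \<longleftrightarrow> (\<exists>g\<in>bdW p \<eta>. [g n = k] (mod int (p n)))"
proof
  assume k: "k \<in> essential_holes p \<eta> n"
  define C where "C i = {g \<in> odometer p. g n = k mod int (p n)} \<inter> {g \<in> odometer p. g (n + i) \<in> holes p \<eta> (n + i)}" for i
  have "(\<Inter>i. C i) \<noteq> {}"
  proof (rule decreasing_closed_nonempty[OF c])
    show "closedin (odometer_top p) (C i)" for i
      unfolding C_def by (intro closedin_Int closedin_coordinate[where P = "\<lambda>x. x = _"] closedin_coordinate)
    show "C i \<noteq> {}" for i
    proof -
      obtain l j where l: "l \<in> holes p \<eta> (n + i)" "l = k + int (p n) * j"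
        using k by (auto simp: essential_holes_def dest!: spec[of _ "n + i"])
      have "Delta p l (n + i) \<in> holes p \<eta> (n + i)"
        using l(1) holes_periodic[of "Delta p l (n + i)" l p "n + i" \<eta>] Delta_coordinate_cong by blast
      moreover have "Delta p l n = k mod int (p n)" by (simp add: Delta_def l(2))
      ultimately have "Delta p l \<in> C i"
        using Delta_in_odometer[OF T] by (simp add: C_def)
      then show ?thesis by blast
    qed
    show "C j \<subseteq> C i" if "i \<le> j" for i j
    proof
      fix g assume g: "g \<in> C j"
      then have go: "g \<in> odometer p" and "g (n + j) \<in> holes p \<eta> (n + j)" by (auto simp: C_def)
      then have "g (n + j) \<in> holes p \<eta> (n + i)" using holes_antimono[OF T, of "n + i" "n + j"] that by auto
      moreover have "[g (n + j) = g (n + i)] (mod int (p (n + i)))"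
        using odometer_cong[OF T go] that by simp
      ultimately have "g (n + i) \<in> holes p \<eta> (n + i)"
        using holes_periodic[where p = p and n = "n + i"] by blast
      then show "g \<in> C i" using g by (auto simp: C_def)
    qed
  qed
  then obtain g where "\<And>i. g \<in> C i" by blast
  note g = this
  have go: "g \<in> odometer p" using g by (auto simp: C_def)
  \<comment> \<open>The sets \<open>C i\<close> only speak of levels from \<open>n\<close> on; the
    lower ones follow because holes decrease with the level.\<close>
  have "g i \<in> holes p \<eta> i" for i
  proof -
    have "g (n + i) \<in> holes p \<eta> i"
      using g[of i] holes_antimono[OF T, of i "n + i"] by (auto simp: C_def)
    moreover have "[g (n + i) = g i] (mod int (p i))"
      using odometer_cong[OF T go] by simp
    ultimately show ?thesis using holes_periodic[where p = p and n = i] by blast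
  qed
  then have "g \<in> bdW p \<eta>" using go by (simp add: bdW_iff[OF T])
  moreover have "[g n = k] (mod int (p n))" using g by (auto simp: C_def cong_def)
  ultimately show "\<exists>g\<in>bdW p \<eta>. [g n = k] (mod int (p n))" by blast
next
  assume "\<exists>g\<in>bdW p \<eta>. [g n = k] (mod int (p n))"
  then obtain g where g: "g \<in> odometer p" "\<And>n. g n \<in> holes p \<eta> n" "[g n = k] (mod int (p n))"
    by (auto simp: bdW_iff[OF T])
  have "holes p \<eta> i \<inter> range (\<lambda>j. k + int (p n) * j) \<noteq> {}" if "i \<ge> n" for i
  proof -
    have "[k = g i] (mod int (p n))"
      by (rule cong_trans[OF cong_sym[OF g(3)] cong_sym[OF odometer_cong[OF T g(1) that]]])
    then obtain j where "g i = k + int (p n) * j" unfolding cong_iff_lin by blast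
    then have "g i \<in> range (\<lambda>j. k + int (p n) * j)" by (rule range_eqI)
    then show ?thesis using g(2)[of i] by blast
  qed
  moreover have "k \<in> holes p \<eta> n" using g(2) holes_periodic[where p = p and n = n, OF g(3)] by blast
  ultimately show "k \<in> essential_holes p \<eta> n" unfolding essential_holes_def by blast
qed

text \<open>The limit hypothesis sums in \<open>ennreal\<close>, where divergence gives infinity
  instead of a default value; this passes to real finite sums.\<close>

lemma finite_sum_less_of_ennreal_infsum:
  fixes f :: "'a \<Rightarrow> real"
  assumes "(\<Sum>\<^sub>\<infinity>a\<in>A. ennreal (f a)) < ennreal \<epsilon>" "\<And>a. a \<in> A \<Longrightarrow> f a \<ge> 0" "finite F" "F \<subseteq> A"
  shows "sum f F < \<epsilon>"
proof -
  have "ennreal (sum f F) = (\<Sum>a\<in>F. ennreal (f a))"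
    using assms(2,4) by (intro sum_ennreal[symmetric]) auto
  also have "\<dots> \<le> (\<Sum>\<^sub>\<infinity>a\<in>A. ennreal (f a))"
    using assms(3,4) by (subst nonneg_infsum_complete) (auto intro: SUP_upper)
  also have "\<dots> < ennreal \<epsilon>" by (rule assms(1))
  finally show ?thesis
    using assms(2,4) by (subst (asm) ennreal_less_iff) (auto intro: sum_nonneg)
qed

text \<open>The open set contains a cylinder of some level \<open>N\<close>. At a high level
  \<open>n\<close>, invariance there would move every essential hole in one class modulo
  \<open>p N\<close> by \<open>k\<close> to an essential hole, against
  \<open>translation_invariance_bound\<close> once the sum is small.\<close>

lemma bdW_translate_not_locally_invariant:
  fixes A :: "nat \<Rightarrow> nat set" and S :: "nat \<Rightarrow> nat \<Rightarrow> nat set"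
  assumes T: "toeplitz p \<eta>" and c: "compact_space (odometer_top p)"
    and A: "\<And>n. 0 \<notin> A n" "\<And>n. primitive_set (A n)"
    and E: "\<And>n. essential_holes p \<eta> n = (\<Union>a\<in>A n. {k. int a dvd k} - multiples (S n a))"
    and ne: "\<And>n a. a \<in> A n \<Longrightarrow> {k. int a dvd k} - multiples (S n a) \<noteq> {}"
    and lim: "(\<lambda>n. \<Sum>\<^sub>\<infinity>a\<in>A n. ennreal (1 / real (totient a))) \<longlonglongrightarrow> 0"
    and k: "k \<noteq> 0" and U: "openin (odometer_top p) U" "U \<inter> bdW p \<eta> \<noteq> {}"
  shows "\<exists>g\<in>U \<inter> bdW p \<eta>. odo_add p g (\<lambda>_. k) \<notin> bdW p \<eta>"
proof (rule ccontr)
  assume "\<not> ?thesis"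
  then have inv: "odo_add p g (\<lambda>_. k) \<in> bdW p \<eta>" if "g \<in> U" "g \<in> bdW p \<eta>" for g
    using that by blast
  obtain h where h: "h \<in> U" "h \<in> bdW p \<eta>" using U(2) by blast
  have ho: "h \<in> odometer p" using h(2) bdW_subset[OF T] by blast
  obtain N where N: "cyl p N h \<subseteq> U" using openin_contains_cyl[OF T U(1) h(1)] by blast
  \<comment> \<open>The reciprocal of the factor in \<open>translation_invariance_bound\<close> with
    \<open>m = p N\<close>.\<close>
  define \<epsilon> where "\<epsilon> = 1 / (real (p N) * real_of_int \<bar>k\<bar>)"
  have pk: "real (p N) * real_of_int \<bar>k\<bar> > 0" using toeplitz_pos[OF T] k by simp
  then have "ennreal \<epsilon> > 0" by (simp add: \<epsilon>_def)
  then have "\<forall>\<^sub>F n in sequentially. (\<Sum>\<^sub>\<infinity>a\<in>A n. ennreal (1 / real (totient a))) < ennreal \<epsilon>"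
    using lim by (rule order_tendstoD(2)[rotated])
  then obtain n where n: "n \<ge> N" "(\<Sum>\<^sub>\<infinity>a\<in>A n. ennreal (1 / real (totient a))) < ennreal \<epsilon>"
    unfolding eventually_sequentially by (meson nle_le)
  have fs: "(\<Sum>a\<in>F. 1 / real (totient a)) < \<epsilon>" if "finite F" "F \<subseteq> A n" for F
    using finite_sum_less_of_ennreal_infsum[OF n(2) _ that] by simp
  \<comment> \<open>Finite sums of \<open>1 / a\<close> are dominated because
    \<open>totient a \<le> a\<close>.\<close>
  have summ: "(\<lambda>a. 1 / real a) summable_on A n"
  proof (rule nonneg_bdd_above_summable_on)
    have "(\<Sum>a\<in>F. 1 / real a) \<le> \<epsilon>" if F: "F \<subseteq> A n" "finite F" for F
    proof -
      have "(\<Sum>a\<in>F. 1 / real a) \<le> (\<Sum>a\<in>F. 1 / real (totient a))"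
      proof (rule sum_mono)
        fix a assume "a \<in> F"
        then have "a > 0" using F A(1) by (metis gr0I subsetD)
        then show "1 / real a \<le> 1 / real (totient a)"
          by (intro divide_left_mono) (auto simp: totient_le)
      qed
      then show ?thesis using fs[OF F(2,1)] by simp
    qed
    then show "bdd_above (sum (\<lambda>a. 1 / real a) ` {F. F \<subseteq> A n \<and> finite F})"
      by (intro bdd_aboveI[of _ \<epsilon>]) auto
  qed simp
  have hn: "h n \<in> essential_holes p \<eta> n"
    unfolding essential_holes_iff[OF T c] using h(2) cong_refl by blast
  have per: "x + int (p n) * j \<in> essential_holes p \<eta> n" if x: "x \<in> essential_holes p \<eta> n" for x j
  proof -
    obtain g where g: "g \<in> bdW p \<eta>" "[g n = x] (mod int (p n))"
      using x unfolding essential_holes_iff[OF T c] by blast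
    then have "[g n = x + int (p n) * j] (mod int (p n))" by (simp add: cong_def)
    then show ?thesis using g(1) unfolding essential_holes_iff[OF T c] by blast
  qed
  have tr: "x + k \<in> essential_holes p \<eta> n"
    if x: "x \<in> essential_holes p \<eta> n" "[x = h n] (mod int (p N))" for x
  proof -
    obtain g where g: "g \<in> bdW p \<eta>" "[g n = x] (mod int (p n))"
      using x(1) unfolding essential_holes_iff[OF T c] by blast
    have go: "g \<in> odometer p" using g(1) bdW_subset[OF T] by blast
    have "[g n = x] (mod int (p N))"
      using g(2) toeplitz_dvd[OF T n(1)] by (meson cong_dvd_modulus int_dvd_int_iff)
    then have "g n mod int (p N) = h n mod int (p N)" using x(2) by (simp add: cong_def)
    \<comment> \<open>The congruence modulo \<open>p N\<close> puts the boundary point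
      \<open>g\<close> above \<open>x\<close> into the cylinder of \<open>h\<close>, hence into
      \<open>U\<close>, where invariance applies.\<close>
    then have "g N = h N"
      using odometer_coherent[OF T go n(1)] odometer_coherent[OF T ho n(1)] by simp
    then have "g \<in> U" using N go by (auto simp: cyl_def)
    then have "odo_add p g (\<lambda>_. k) \<in> bdW p \<eta>" using inv g(1) by blast
    moreover have "[odo_add p g (\<lambda>_. k) n = x + k] (mod int (p n))"
    proof -
      have "[g n + k = x + k] (mod int (p n))" using g(2) cong_refl by (rule cong_add)
      then show ?thesis by (simp add: odo_add_def cong_def)
    qed
    ultimately show ?thesis unfolding essential_holes_iff[OF T c] by blast
  qed
  have pN: "p N dvd p n" using toeplitz_dvd[OF T n(1)] .
  note bound = translation_invariance_bound[OF E[of n] per A(1)[of n] A(2)[of n] summ ne[of _ n]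
      toeplitz_pos[OF T] pN k hn tr]
  have "(\<Sum>a\<in>A n. 1 / real (totient a)) < \<epsilon>" using fs bound(1) by blast
  then have "real (p N) * real_of_int \<bar>k\<bar> * (\<Sum>a\<in>A n. 1 / real (totient a)) < 1"
    using pk by (simp add: \<epsilon>_def field_simps)
  then show False using bound(2) by linarith
qed

section \<open>The factor map onto the odometer\<close>

definition translate :: "int \<Rightarrow> (int \<Rightarrow> bool) \<Rightarrow> (int \<Rightarrow> bool)" where
  "translate j x = (\<lambda>k. x (k + j))"

lemma translate_0 [simp]: "translate 0 x = x"
  by (simp add: translate_def)

lemma shift_translate: "shift (translate j x) = translate (j + 1) x"
  by (simp add: translate_def shift_def add_ac)

lemma inj_shift: "inj shift"
proof (rule injI)
  fix x z assume "shift x = shift z"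
  then have "shift x (k - 1) = shift z (k - 1)" for k by simp
  then show "x = z" by (auto simp: shift_def)
qed

lemma continuous_on_translate: "continuous_on UNIV (translate j)"
  unfolding translate_def
  by (intro continuous_on_coordinatewise_then_product continuous_on_product_coordinates)

lemma orbit_closure_eq: "orbit_closure \<eta> = closure (range (\<lambda>j. translate j \<eta>))"
  by (simp add: orbit_closure_def translate_def)

lemma closed_orbit_closure: "closed (orbit_closure \<eta>)"
  by (simp add: orbit_closure_def)

lemma compact_orbit_closure: "compact (orbit_closure \<eta>)"
proof -
  have "compact_space (euclidean :: bool topology)"
    using finite_imp_compact[of "UNIV :: bool set"] by (simp add: compact_space_def)
  then have "compact_space (product_topology (\<lambda>_::int. euclidean :: bool topology) UNIV)"
    by (simp add: compact_space_product_topology)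
  then have "compact (UNIV :: (int \<Rightarrow> bool) set)"
    by (simp only: euclidean_product_topology compact_space_def topspace_euclidean compactin_euclidean_iff)
  from compact_Int_closed[OF this closed_orbit_closure[of \<eta>]] show ?thesis by simp
qed

lemma translate_orbit: "translate j \<eta> \<in> orbit_closure \<eta>"
  unfolding orbit_closure_eq by (rule subsetD[OF closure_subset]) simp

lemma orbit_closure_translate:
  assumes "x \<in> orbit_closure \<eta>" shows "translate j x \<in> orbit_closure \<eta>"
proof -
  have "translate j ` closure (range (\<lambda>i. translate i \<eta>)) \<subseteq> orbit_closure \<eta>"
  proof (rule image_closure_subset)
    show "translate j ` range (\<lambda>i. translate i \<eta>) \<subseteq> orbit_closure \<eta>"
    proof clarify
      fix i
      have "translate j (translate i \<eta>) = translate (j + i) \<eta>"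
        by (simp add: translate_def add_ac)
      then show "translate j (translate i \<eta>) \<in> orbit_closure \<eta>" by (simp add: translate_orbit)
    qed
  qed (auto intro: continuous_on_subset[OF continuous_on_translate] simp: closed_orbit_closure)
  then show ?thesis using assms by (auto simp: orbit_closure_eq)
qed

lemma orbit_closure_induct:
  assumes "closed {x \<in> orbit_closure \<eta>. P x}" "\<And>j. P (translate j \<eta>)" "x \<in> orbit_closure \<eta>"
  shows "P x"
proof -
  have "closure (range (\<lambda>j. translate j \<eta>)) \<subseteq> {x \<in> orbit_closure \<eta>. P x}"
    by (rule closure_minimal) (use assms(1,2) translate_orbit in auto)
  then show ?thesis using assms(3) by (auto simp: orbit_closure_eq)
qed

lemma closed_Collect_discrete:
  fixes f :: "'a::topological_space \<Rightarrow> 'b::discrete_topology"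
  assumes "continuous_on X f" "closed X"
  shows "closed {x \<in> X. P (f x)}"
proof -
  have "closed (X \<inter> f -` {y. P y})"
    using assms by (intro continuous_closed_preimage) (auto simp: closed_def open_discrete)
  moreover have "X \<inter> f -` {y. P y} = {x \<in> X. P (f x)}" by auto
  ultimately show ?thesis by simp
qed

section \<open>Translations of the odometer\<close>

lemma odometer_mod: "g \<in> odometer p \<Longrightarrow> g n mod int (p n) = g n"
  by (simp add: odometer_def)

text \<open>The second argument of \<open>odo_add\<close> may be any coherent integer sequence,
  reduced or not. So the constant sequence \<open>k\<close> acts as \<open>Delta p k\<close>, and
  differences such as \<open>y n - k\<close> need no normalisation.\<close>

lemma odo_add_in_odometer:
  assumes T: "toeplitz p \<eta>" and g: "g \<in> odometer p"
    and z: "\<And>n. [z (Suc n) = z n] (mod int (p n))"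
  shows "odo_add p g z \<in> odometer p"
proof -
  have "(g (Suc n) + z (Suc n)) mod int (p (Suc n)) mod int (p n) = (g n + z n) mod int (p n)" for n
  proof -
    have "(g (Suc n) + z (Suc n)) mod int (p (Suc n)) mod int (p n) = (g (Suc n) + z (Suc n)) mod int (p n)"
      using toeplitz_dvd[OF T, of n "Suc n"] by (simp add: mod_mod_cancel)
    also have "\<dots> = (g n + z n) mod int (p n)"
      using cong_add[OF odometer_cong[OF T g, of n "Suc n"] z[of n]] by (simp add: cong_def)
    finally show ?thesis .
  qed
  then show ?thesis using toeplitz_pos[OF T] by (simp add: odometer_def odo_add_def)
qed

lemma odo_add_add: "odo_add p (odo_add p g z) w = odo_add p g (\<lambda>n. z n + w n)"
  by (simp add: odo_add_def mod_simps add_ac)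

lemma odo_add_0: "g \<in> odometer p \<Longrightarrow> odo_add p g (\<lambda>_. 0) = g"
  by (simp add: odo_add_def odometer_mod)

section \<open>Fibres of the factor map\<close>

locale toeplitz_factor =
  fixes p :: "nat \<Rightarrow> nat" and \<eta> :: "int \<Rightarrow> bool" and \<pi> :: "(int \<Rightarrow> bool) \<Rightarrow> (nat \<Rightarrow> int)"
  assumes toeplitz: "toeplitz p \<eta>"
    and factor: "factor_map (top_of_set (orbit_closure \<eta>)) shift (odometer_top p) (odo_T p) \<pi>"
    and base: "\<pi> \<eta> = Delta p 0"
begin

lemma factor_in_odometer: "x \<in> orbit_closure \<eta> \<Longrightarrow> \<pi> x \<in> odometer p"
  using factor by (auto simp: factor_map_def)

lemma continuous_factor_coordinate: "continuous_on (orbit_closure \<eta>) (\<lambda>x. \<pi> x n)"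
proof -
  have "continuous_map (top_of_set (orbit_closure \<eta>)) (odometer_top p) \<pi>"
    using factor by (simp add: factor_map_def)
  then have "continuous_on (orbit_closure \<eta>) \<pi>"
    by (simp add: continuous_map_in_subtopology)
  then show ?thesis by (rule continuous_on_product_then_coordinatewise)
qed

lemma closed_factor_coordinate: "closed {x \<in> orbit_closure \<eta>. P (\<pi> x n)}"
  by (rule closed_Collect_discrete[OF continuous_factor_coordinate closed_orbit_closure])

lemma closed_coordinate: "closed {x \<in> orbit_closure \<eta>. P (x k)}"
  by (rule closed_Collect_discrete[OF _ closed_orbit_closure])
    (rule continuous_on_product_then_coordinatewise[OF continuous_on_id])

lemma factor_translate:
  assumes x: "x \<in> orbit_closure \<eta>"
  shows "\<pi> (translate j x) = odo_add p (\<pi> x) (\<lambda>_. j)"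
proof -
  have step: "\<pi> (translate (i + 1) x) = odo_add p (\<pi> (translate i x)) (\<lambda>_. 1)" for i
  proof -
    have "\<pi> (shift (translate i x)) = odo_T p (\<pi> (translate i x))"
      using factor orbit_closure_translate[OF x] by (simp add: factor_map_def)
    then show ?thesis by (simp add: shift_translate odo_T_def odo_add_def Delta_def mod_simps)
  qed
  show ?thesis
  proof (induction j rule: int_induct[where k = 0])
    case base
    then show ?case using odo_add_0 factor_in_odometer[OF x] by simp
  next
    case (step1 i)
    then show ?case using step[of i] by (simp add: odo_add_add)
  next
    case (step2 i)
    have "\<pi> (translate i x) = odo_add p (\<pi> (translate (i - 1) x)) (\<lambda>_. 1)"
      using step[of "i - 1"] by simp
    then have "odo_add p (\<pi> (translate i x)) (\<lambda>_. - 1) = \<pi> (translate (i - 1) x)"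
      using odo_add_0 factor_in_odometer orbit_closure_translate[OF x] by (simp add: odo_add_add)
    then show ?case using step2 by (simp add: odo_add_add)
  qed
qed

lemma factor_translate_base: "\<pi> (translate j \<eta>) = Delta p j"
  using factor_translate[of \<eta> j] translate_orbit[of 0 \<eta>] base
  by (simp add: odo_add_def Delta_def)

text \<open>On the orbit of \<open>\<eta>\<close> this is the constancy of \<open>\<eta>\<close> on
  a residue class, read through \<open>factor_translate_base\<close>. It passes to limits because
  the condition is closed.\<close>

lemma factor_determines:
  assumes x: "x \<in> orbit_closure \<eta>" and V: "odo_add p (\<pi> x) (\<lambda>_. k) \<in> V_part p \<eta> i"
  shows "x k = i"
proof -
  obtain n where n: "(\<pi> x n + k) mod int (p n) \<in> per_part p \<eta> i n"
    using V by (auto simp: V_part_iff[OF toeplitz] odo_add_def)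
  have "(\<pi> x n + k) mod int (p n) \<in> per_part p \<eta> i n \<longrightarrow> x k = i"
  proof (rule orbit_closure_induct[OF _ _ x])
    \<comment> \<open>The premise depends on one discrete coordinate of \<open>\<pi> x\<close>, so
      its negation also defines a closed set.\<close>
    have "closed ({x \<in> orbit_closure \<eta>. (\<pi> x n + k) mod int (p n) \<notin> per_part p \<eta> i n}
        \<union> {x \<in> orbit_closure \<eta>. x k = i})"
      by (intro closed_Un closed_factor_coordinate closed_coordinate)
    moreover have "{x \<in> orbit_closure \<eta>. (\<pi> x n + k) mod int (p n) \<notin> per_part p \<eta> i n}
        \<union> {x \<in> orbit_closure \<eta>. x k = i}
        = {x \<in> orbit_closure \<eta>. (\<pi> x n + k) mod int (p n) \<in> per_part p \<eta> i n \<longrightarrow> x k = i}"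
      by auto
    ultimately show "closed {x \<in> orbit_closure \<eta>.
        (\<pi> x n + k) mod int (p n) \<in> per_part p \<eta> i n \<longrightarrow> x k = i}" by simp
    show "(\<pi> (translate j \<eta>) n + k) mod int (p n) \<in> per_part p \<eta> i n \<longrightarrow> translate j \<eta> k = i" for j
    proof
      assume "(\<pi> (translate j \<eta>) n + k) mod int (p n) \<in> per_part p \<eta> i n"
      then have "\<eta> (k + j) = i"
        by (rule per_part_cong) (simp add: factor_translate_base Delta_def mod_simps add_ac)
      then show "translate j \<eta> k = i" by (simp add: translate_def)
    qed
  qed
  then show ?thesis using n by simp
qed

lemma differing_in_fibre_imp_bdW:
  assumes "x \<in> orbit_closure \<eta>" "x' \<in> orbit_closure \<eta>" "\<pi> x = \<pi> x'" "x k \<noteq> x' k"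
  shows "odo_add p (\<pi> x) (\<lambda>_. k) \<in> bdW p \<eta>"
proof -
  have "odo_add p (\<pi> x) (\<lambda>_. k) \<in> odometer p"
    using odo_add_in_odometer[OF toeplitz factor_in_odometer[OF assms(1)]] by simp
  moreover have "odo_add p (\<pi> x) (\<lambda>_. k) \<notin> V_part p \<eta> i" for i
    using factor_determines[OF assms(1), of k i] factor_determines[OF assms(2), of k i] assms(3,4)
    by auto
  ultimately show ?thesis by (simp add: bdW_eq[OF toeplitz])
qed

text \<open>At a hole both symbols occur along the class of \<open>g n\<close> modulo
  \<open>p n\<close>. Translating \<open>\<eta>\<close> to such a position gives a point with symbol
  \<open>i\<close> at 0 that lies over \<open>g\<close> at level \<open>n\<close>; compactness
  yields one that does so at all levels.\<close>

lemma bdW_imp_both_values: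
  assumes g: "g \<in> bdW p \<eta>"
  shows "\<exists>x\<in>orbit_closure \<eta>. \<pi> x = g \<and> x 0 = i"
proof -
  have go: "g \<in> odometer p" using g bdW_subset[OF toeplitz] by blast
  define C where "C n = {x \<in> orbit_closure \<eta>. \<pi> x n = g n} \<inter> {x \<in> orbit_closure \<eta>. x 0 = i}" for n
  have "(\<Inter>n. C n) \<noteq> {}"
  proof (rule decreasing_closed_nonempty)
    show "compact_space (top_of_set (orbit_closure \<eta>))"
      using compact_orbit_closure by (simp add: compact_space_subtopology)
    show "closedin (top_of_set (orbit_closure \<eta>)) (C n)" for n
    proof -
      have "closed (C n)" unfolding C_def
        by (intro closed_Int closed_factor_coordinate closed_coordinate)
      then show ?thesis by (rule closed_subset[rotated]) (auto simp: C_def)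
    qed
    show "C n \<noteq> {}" for n
    proof -
      have "g n \<in> holes p \<eta> n" using g by (simp add: bdW_iff[OF toeplitz])
      then have "g n \<notin> per_part p \<eta> (\<not> i) n" by (cases i) (auto simp: holes_def)
      then obtain j where j: "\<eta> (g n + int (p n) * j) = i" by (auto simp: per_part_def)
      define l where "l = g n + int (p n) * j"
      have "\<pi> (translate l \<eta>) n = g n"
        using odometer_mod[OF go] by (simp add: factor_translate_base Delta_def l_def)
      moreover have "translate l \<eta> 0 = i" using j by (simp add: translate_def l_def)
      ultimately have "translate l \<eta> \<in> C n" by (simp add: C_def translate_orbit)
      then show ?thesis by blast
    qed
    show "C m \<subseteq> C n" if "n \<le> m" for n m
    proof
      fix x assume x: "x \<in> C m"
      then have xo: "x \<in> orbit_closure \<eta>" by (simp add: C_def)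
      have "\<pi> x n = g n"
        using odometer_coherent[OF toeplitz factor_in_odometer[OF xo] that]
          odometer_coherent[OF toeplitz go that] x by (simp add: C_def)
      then show "x \<in> C n" using x by (simp add: C_def)
    qed
  qed
  then obtain x where "\<And>n. x \<in> C n" by blast
  then have "x \<in> orbit_closure \<eta>" "\<pi> x = g" "x 0 = i" by (auto simp: C_def)
  then show ?thesis by blast
qed

end

section \<open>Automorphisms\<close>

lemma closed_Collect_eq_on:
  fixes f g :: "'a::topological_space \<Rightarrow> 'b::t2_space"
  assumes "continuous_on X f" "continuous_on X g" "closed X"
  shows "closed {x \<in> X. f x = g x}"
proof -
  have "closed (X \<inter> (\<lambda>x. (f x, g x)) -` {y. \<exists>x. y = (x, x)})"
    using assms by (intro continuous_closed_preimage continuous_on_Pair closed_diagonal)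
  moreover have "X \<inter> (\<lambda>x. (f x, g x)) -` {y. \<exists>x. y = (x, x)} = {x \<in> X. f x = g x}" by auto
  ultimately show ?thesis by simp
qed

context toeplitz_factor
begin

context
  fixes F :: "(int \<Rightarrow> bool) \<Rightarrow> (int \<Rightarrow> bool)"
  assumes F: "automorphism \<eta> F"
begin

lemma automorphism_image: "F ` orbit_closure \<eta> = orbit_closure \<eta>"
  using F homeomorphic_imp_surjective_map[of "top_of_set (orbit_closure \<eta>)" "top_of_set (orbit_closure \<eta>)" F]
  by (simp add: automorphism_def)

lemma automorphism_inj: "inj_on F (orbit_closure \<eta>)"
  using F homeomorphic_imp_injective_map[of "top_of_set (orbit_closure \<eta>)" "top_of_set (orbit_closure \<eta>)" F]
  by (simp add: automorphism_def)

lemma automorphism_in: "x \<in> orbit_closure \<eta> \<Longrightarrow> F x \<in> orbit_closure \<eta>"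
  using automorphism_image by blast

lemma automorphism_continuous: "continuous_on (orbit_closure \<eta>) F"
proof -
  have "continuous_map (top_of_set (orbit_closure \<eta>)) (top_of_set (orbit_closure \<eta>)) F"
    using F homeomorphic_imp_continuous_map unfolding automorphism_def by blast
  then show ?thesis by (simp add: continuous_map_in_subtopology)
qed

lemma automorphism_translate:
  assumes x: "x \<in> orbit_closure \<eta>"
  shows "F (translate j x) = translate j (F x)"
proof -
  have step: "F (translate (i + 1) x) = shift (F (translate i x))" for i
  proof -
    have "F (shift (translate i x)) = shift (F (translate i x))"
      using F orbit_closure_translate[OF x, of i] by (simp add: automorphism_def)
    then show ?thesis by (simp add: shift_translate)
  qed
  show ?thesis
  proof (induction j rule: int_induct[where k = 0])
    case base
    then show ?case by simp
  next
    case (step1 i)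
    then show ?case using step[of i] by (simp add: shift_translate)
  next
    case (step2 i)
    have "shift (F (translate (i - 1) x)) = F (translate i x)"
      using step[of "i - 1"] by simp
    also have "\<dots> = shift (translate (i - 1) (F x))"
      using step2 by (simp add: shift_translate)
    finally show ?case using inj_shift by (simp add: inj_eq)
  qed
qed

text \<open>Both sides are continuous in each coordinate, and they agree on the orbit of
  \<open>\<eta>\<close> since \<open>F\<close> commutes with translations.\<close>

lemma factor_automorphism:
  assumes x: "x \<in> orbit_closure \<eta>"
  shows "\<pi> (F x) = odo_add p (\<pi> x) (\<pi> (F \<eta>))"
proof -
  have \<eta>: "\<eta> \<in> orbit_closure \<eta>" using translate_orbit[of 0 \<eta>] by simp
  have "\<pi> (F x) n = (\<pi> x n + \<pi> (F \<eta>) n) mod int (p n)" for n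
  proof (rule orbit_closure_induct[OF _ _ x])
    have "continuous_on (orbit_closure \<eta>) (\<lambda>x. \<pi> (F x) n)"
      using continuous_on_compose2[OF continuous_factor_coordinate automorphism_continuous]
        automorphism_image by blast
    moreover have "continuous_on (orbit_closure \<eta>) (\<lambda>x. (\<pi> x n + \<pi> (F \<eta>) n) mod int (p n))"
      using continuous_on_compose2[OF _ continuous_factor_coordinate subset_UNIV,
          where g = "\<lambda>k. (k + \<pi> (F \<eta>) n) mod int (p n)"] by simp
    ultimately show "closed {x \<in> orbit_closure \<eta>. \<pi> (F x) n = (\<pi> x n + \<pi> (F \<eta>) n) mod int (p n)}"
      by (rule closed_Collect_eq_on[OF _ _ closed_orbit_closure])
    show "\<pi> (F (translate j \<eta>)) n = (\<pi> (translate j \<eta>) n + \<pi> (F \<eta>) n) mod int (p n)" for j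
      using factor_translate[OF automorphism_in[OF \<eta>], of j]
      by (simp add: automorphism_translate[OF \<eta>] factor_translate_base odo_add_def Delta_def mod_simps add_ac)
  qed
  then show ?thesis by (auto simp: odo_add_def)
qed

lemma aut_rotation_eq: "aut_rotation p \<eta> \<pi> F = \<pi> (F \<eta>)"
proof -
  have \<eta>: "\<eta> \<in> orbit_closure \<eta>" using translate_orbit[of 0 \<eta>] by simp
  show ?thesis unfolding aut_rotation_def
  proof (rule the_equality)
    show "\<pi> (F \<eta>) \<in> odometer p \<and> (\<forall>x\<in>orbit_closure \<eta>. \<pi> (F x) = odo_add p (\<pi> x) (\<pi> (F \<eta>)))"
      using factor_automorphism factor_in_odometer automorphism_in[OF \<eta>] by blast
    fix y assume y: "y \<in> odometer p \<and> (\<forall>x\<in>orbit_closure \<eta>. \<pi> (F x) = odo_add p (\<pi> x) y)"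
    \<comment> \<open>Evaluation at \<open>\<eta>\<close>, which lies over the neutral element,
      gives uniqueness.\<close>
    then have "\<pi> (F \<eta>) = odo_add p (Delta p 0) y" using \<eta> base by metis
    then show "y = \<pi> (F \<eta>)" using y by (auto simp: odo_add_def Delta_def odometer_mod)
  qed
qed

text \<open>Choose \<open>v\<close> and \<open>w\<close> whose images lie over \<open>h\<close> and
  differ at 0; both lie in one fibre, that of \<open>h\<close> minus the rotation. The code reads
  only the window, so they differ at some \<open>l\<close> in it, and points of one fibre differ
  only over the boundary.\<close>

lemma bdW_backward:
  assumes code: "has_block_code \<eta> F m" and h: "h \<in> bdW p \<eta>"
  shows "\<exists>l\<in>{- int m..int m}. odo_add p h (\<lambda>n. l - \<pi> (F \<eta>) n) \<in> bdW p \<eta>"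
proof -
  obtain v' w' where v': "v' \<in> orbit_closure \<eta>" "\<pi> v' = h" "v' 0 = True"
    and w': "w' \<in> orbit_closure \<eta>" "\<pi> w' = h" "w' 0 = False"
    using bdW_imp_both_values[OF h, of True] bdW_imp_both_values[OF h, of False] by blast
  obtain v w where v: "v \<in> orbit_closure \<eta>" "\<pi> (F v) = h" "F v 0"
    and w: "w \<in> orbit_closure \<eta>" "\<pi> (F w) = h" "\<not> F w 0"
  proof -
    have "v' \<in> F ` orbit_closure \<eta>" "w' \<in> F ` orbit_closure \<eta>"
      using v'(1) w'(1) automorphism_image by simp_all
    then show thesis using that v'(2,3) w'(2,3) by auto
  qed
  have fib: "\<pi> u = odo_add p h (\<lambda>n. - \<pi> (F \<eta>) n)" if u: "u \<in> orbit_closure \<eta>" "\<pi> (F u) = h" for u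
  proof -
    have "odo_add p h (\<lambda>n. - \<pi> (F \<eta>) n) = odo_add p (\<pi> u) (\<lambda>_. 0)"
      using factor_automorphism[OF u(1)] u(2) by (simp add: odo_add_add)
    then show ?thesis using odo_add_0 factor_in_odometer[OF u(1)] by simp
  qed
  obtain c where c: "\<And>x s. x \<in> orbit_closure \<eta> \<Longrightarrow> F x s = c (\<lambda>i\<in>{- int m..int m}. x (s + i))"
    using code by (auto simp: has_block_code_def)
  have "\<exists>l\<in>{- int m..int m}. v l \<noteq> w l"
  proof (rule ccontr)
    assume "\<not> ?thesis"
    then have "(\<lambda>i\<in>{- int m..int m}. v (0 + i)) = (\<lambda>i\<in>{- int m..int m}. w (0 + i))"
      by (intro restrict_ext) auto
    then show False using c[OF v(1), of 0] c[OF w(1), of 0] v(3) w(3) by simp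
  qed
  then obtain l where l: "l \<in> {- int m..int m}" "v l \<noteq> w l" by blast
  have "odo_add p (\<pi> v) (\<lambda>_. l) \<in> bdW p \<eta>"
    using differing_in_fibre_imp_bdW[OF v(1) w(1) _ l(2)] fib v w by simp
  then have "odo_add p h (\<lambda>n. l - \<pi> (F \<eta>) n) \<in> bdW p \<eta>"
    using fib[OF v(1,2)] by (simp add: odo_add_add)
  then show ?thesis using l(1) by blast
qed

text \<open>Compactness replaces the block code of the inverse automorphism here.\<close>

lemma automorphism_separates:
  "\<exists>M::nat. \<forall>v\<in>orbit_closure \<eta>. \<forall>w\<in>orbit_closure \<eta>. v 0 \<longrightarrow> \<not> w 0 \<longrightarrow>
     (\<exists>i\<in>{- int M..int M}. F v i \<noteq> F w i)"
proof (rule ccontr)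
  let ?X = "orbit_closure \<eta>"
  assume neg: "\<not> ?thesis"
  \<comment> \<open>A common point of all \<open>C M\<close> is a pair of distinct points with the
    same image, against injectivity of \<open>F\<close>.\<close>
  define C where "C M = {z \<in> ?X \<times> ?X. fst z 0} \<inter> {z \<in> ?X \<times> ?X. \<not> snd z 0}
      \<inter> (\<Inter>i\<in>{- int M..int M}. {z \<in> ?X \<times> ?X. F (fst z) i = F (snd z) i})" for M :: nat
  have co: "continuous_on (?X \<times> ?X) (\<lambda>z. F (fst z) i)" "continuous_on (?X \<times> ?X) (\<lambda>z. F (snd z) i)" for i
  proof -
    have 1: "continuous_on ?X (\<lambda>x. F x i)"
      by (rule continuous_on_product_then_coordinatewise[OF automorphism_continuous])
    show "continuous_on (?X \<times> ?X) (\<lambda>z. F (fst z) i)"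
      by (rule continuous_on_compose2[OF 1 continuous_on_fst[OF continuous_on_id]]) auto
    show "continuous_on (?X \<times> ?X) (\<lambda>z. F (snd z) i)"
      by (rule continuous_on_compose2[OF 1 continuous_on_snd[OF continuous_on_id]]) auto
  qed
  have cl: "closed (?X \<times> ?X)" by (intro closed_Times closed_orbit_closure)
  have "(\<Inter>M. C M) \<noteq> {}"
  proof (rule decreasing_closed_nonempty)
    show "compact_space (top_of_set (?X \<times> ?X))"
      using compact_Times[OF compact_orbit_closure compact_orbit_closure] by (simp add: compact_space_subtopology)
    show "closedin (top_of_set (?X \<times> ?X)) (C M)" for M
    proof -
      have "closed {z \<in> ?X \<times> ?X. fst z 0}" "closed {z \<in> ?X \<times> ?X. \<not> snd z 0}"
        by (rule closed_Collect_discrete[where P = "\<lambda>b. b", OF _ cl] closed_Collect_discrete[where P = Not, OF _ cl];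
            rule continuous_on_product_then_coordinatewise, intro continuous_intros)+
      moreover have "closed {z \<in> ?X \<times> ?X. F (fst z) i = F (snd z) i}" for i
        by (rule closed_Collect_eq_on[OF co cl])
      ultimately have "closed (C M)" unfolding C_def by (intro closed_Int closed_INT ballI)
      then show ?thesis by (rule closed_subset[rotated]) (auto simp: C_def)
    qed
    show "C M \<noteq> {}" for M
    proof -
      obtain v w where "v \<in> ?X" "w \<in> ?X" "v 0" "\<not> w 0" "\<And>i. i \<in> {- int M..int M} \<Longrightarrow> F v i = F w i"
        using neg by blast
      then have "(v, w) \<in> C M" by (simp add: C_def)
      then show ?thesis by blast
    qed
    show "C n \<subseteq> C m" if "m \<le> n" for m n using that by (auto simp: C_def)
  qed
  then obtain z where z: "\<And>M. z \<in> C M" by blast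
  have X: "fst z \<in> ?X" "snd z \<in> ?X" "fst z 0" "\<not> snd z 0" using z[of 0] by (auto simp: C_def)
  have "F (fst z) i = F (snd z) i" for i
  proof -
    have "\<forall>j\<in>{- \<bar>i\<bar>..\<bar>i\<bar>}. F (fst z) j = F (snd z) j"
      using z[of "nat \<bar>i\<bar>"] by (simp add: C_def)
    moreover have "i \<in> {- \<bar>i\<bar>..\<bar>i\<bar>}" by auto
    ultimately show ?thesis by blast
  qed
  then have "F (fst z) = F (snd z)" by blast
  then have "fst z = snd z" using automorphism_inj X by (auto dest: inj_onD)
  then show False using X by simp
qed

text \<open>\<open>bdW_backward\<close> with source and image exchanged: points over
  \<open>h\<close> that differ at 0 have images in one fibre, differing within a window of uniform
  size. Uniformity makes finitely many \<open>k\<close> suffice for the whole boundary.\<close>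

lemma bdW_forward:
  "\<exists>M::nat. \<forall>h\<in>bdW p \<eta>. \<exists>k\<in>{- int M..int M}. odo_add p h (\<lambda>n. \<pi> (F \<eta>) n - k) \<in> bdW p \<eta>"
proof -
  obtain M :: nat where M: "\<And>v w. v \<in> orbit_closure \<eta> \<Longrightarrow> w \<in> orbit_closure \<eta> \<Longrightarrow> v 0 \<Longrightarrow> \<not> w 0 \<Longrightarrow>
     (\<exists>i\<in>{- int M..int M}. F v i \<noteq> F w i)"
    using automorphism_separates by blast
  have "\<exists>k\<in>{- int M..int M}. odo_add p h (\<lambda>n. \<pi> (F \<eta>) n - k) \<in> bdW p \<eta>" if h: "h \<in> bdW p \<eta>" for h
  proof -
    obtain v w where v: "v \<in> orbit_closure \<eta>" "\<pi> v = h" "v 0"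
      and w: "w \<in> orbit_closure \<eta>" "\<pi> w = h" "\<not> w 0"
      using bdW_imp_both_values[OF h, of True] bdW_imp_both_values[OF h, of False] by auto
    obtain i where i: "i \<in> {- int M..int M}" "F v i \<noteq> F w i" using M v w by blast
    have "\<pi> (F v) = odo_add p h (\<pi> (F \<eta>))" "\<pi> (F w) = odo_add p h (\<pi> (F \<eta>))"
      using factor_automorphism v w by simp_all
    then have "odo_add p (odo_add p h (\<pi> (F \<eta>))) (\<lambda>_. i) \<in> bdW p \<eta>"
      using differing_in_fibre_imp_bdW[OF automorphism_in[OF v(1)] automorphism_in[OF w(1)] _ i(2)] by simp
    then have "odo_add p h (\<lambda>n. \<pi> (F \<eta>) n - (- i)) \<in> bdW p \<eta>" by (simp add: odo_add_add)
    moreover have "- i \<in> {- int M..int M}" using i(1) by auto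
    ultimately show ?thesis by blast
  qed
  then show ?thesis by blast
qed

end

end

section \<open>Nowhere dense translates of the boundary\<close>

lemma continuous_on_odo_add: "continuous_on UNIV (\<lambda>g. odo_add p g z)"
  unfolding odo_add_def
proof (rule continuous_on_coordinatewise_then_product)
  fix n
  show "continuous_on UNIV (\<lambda>g. (g n + z n) mod int (p n))"
    using continuous_on_compose2[OF _ continuous_on_product_coordinates subset_UNIV,
        where g = "\<lambda>k. (k + z n) mod int (p n)"] by simp
qed

lemma open_odo_add_vimage: "open T \<Longrightarrow> open {g. odo_add p g z \<in> T}"
  using open_vimage[OF _ continuous_on_odo_add] by (simp add: vimage_def)

lemma closed_odo_add_vimage: "closed T \<Longrightarrow> closed {g. odo_add p g z \<in> T}"
  using closed_vimage[OF _ continuous_on_odo_add] by (simp add: vimage_def)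

lemma closed_coordinate_odometer: "closed {g :: nat \<Rightarrow> int. P (g n)}"
  using closed_Collect_discrete[OF continuous_on_product_coordinates closed_UNIV, of P] by simp

lemma closed_odometer: "closed (odometer p)"
proof -
  have "closed {g :: nat \<Rightarrow> int. g (Suc n) mod int (p n) = g n}" for n
  proof -
    have "continuous_on UNIV (\<lambda>g :: nat \<Rightarrow> int. g (Suc n) mod int (p n))"
      using continuous_on_compose2[OF _ continuous_on_product_coordinates subset_UNIV,
          where g = "\<lambda>k. k mod int (p n)"] by simp
    then show ?thesis
      using closed_Collect_eq_on[OF _ continuous_on_product_coordinates closed_UNIV] by simp
  qed
  then show ?thesis unfolding odometer_def
    by (intro closed_Collect_all closed_Collect_conj closed_coordinate_odometer)
qed

lemma closed_bdW: "closed (bdW p \<eta>)"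
  by (rule closedin_closed_trans[OF closedin_bdW closed_odometer])

text \<open>Nowhere density in \<open>B\<close> for closed sets, phrased with ambient open sets so
  that no relative interiors appear; \<open>C\<close> may leave \<open>B\<close>.\<close>

definition nowhere_dense_rel :: "'a::topological_space set \<Rightarrow> 'a set \<Rightarrow> bool" where
  "nowhere_dense_rel B C \<longleftrightarrow> closed C \<and> (\<forall>T. open T \<longrightarrow> T \<inter> B \<noteq> {} \<longrightarrow> \<not> T \<inter> B \<subseteq> C)"

text \<open>Removing the closed sets one at a time leaves an open set that still meets
  \<open>B\<close>. This supplies the generic boundary points used below.\<close>

lemma avoid_finite_nowhere_dense:
  assumes "finite I" "\<And>i. i \<in> I \<Longrightarrow> nowhere_dense_rel B (C i)" "open T" "T \<inter> B \<noteq> {}"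
  shows "\<exists>g\<in>T \<inter> B. \<forall>i\<in>I. g \<notin> C i"
  using assms
proof (induction I arbitrary: T rule: finite_induct)
  case empty
  then show ?case by auto
next
  case (insert i I)
  have C: "closed (C i)" "\<not> T \<inter> B \<subseteq> C i"
    using insert.prems by (auto simp: nowhere_dense_rel_def)
  have "\<exists>g\<in>(T \<inter> - C i) \<inter> B. \<forall>i\<in>I. g \<notin> C i"
    using C insert.prems by (intro insert.IH) auto
  then show ?case by auto
qed

lemma nowhere_dense_in_of_rel:
  assumes "nowhere_dense_rel B C" "C \<subseteq> B"
  shows "nowhere_dense_in (top_of_set B) C"
proof -
  have C: "closed C" using assms(1) by (simp add: nowhere_dense_rel_def)
  then have "top_of_set B closure_of C = C"
    using assms(2) by (simp add: closure_of_eq closed_subset)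
  moreover have "top_of_set B interior_of C = {}"
  proof (rule ccontr)
    assume "top_of_set B interior_of C \<noteq> {}"
    moreover obtain T where T: "open T" "top_of_set B interior_of C = B \<inter> T"
      using openin_interior_of[of "top_of_set B" C] unfolding openin_open by blast
    moreover have "top_of_set B interior_of C \<subseteq> C" by (rule interior_of_subset)
    ultimately show False using assms(1) by (auto simp: nowhere_dense_rel_def Int_commute)
  qed
  ultimately show ?thesis using assms(2) by (simp add: nowhere_dense_in_def)
qed

text \<open>Translation by \<open>k - y\<close> is inverted by translation by \<open>y - k\<close>,
  which turns the image in the definition into a membership condition.\<close>

lemma V_set_eq:
  assumes "toeplitz p \<eta>" "y \<in> odometer p"
  shows "V_set p \<eta> y k = {g \<in> bdW p \<eta>. odo_add p g (\<lambda>n. y n - k) \<in> bdW p \<eta>}"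
proof -
  have m: "odo_minus p (odo_add p b (Delta p k)) y = odo_add p b (\<lambda>n. k - y n)" for b
    by (auto simp: odo_minus_def odo_add_def Delta_def mod_simps algebra_simps)
  have i1: "odo_add p (odo_add p b (\<lambda>n. k - y n)) (\<lambda>n. y n - k) = b"
    and i2: "odo_add p (odo_add p b (\<lambda>n. y n - k)) (\<lambda>n. k - y n) = b" if "b \<in> bdW p \<eta>" for b
    using odo_add_0 that bdW_subset[OF assms(1)] by (auto simp: odo_add_add)
  show ?thesis
  proof (intro set_eqI iffI)
    fix g assume "g \<in> V_set p \<eta> y k"
    then show "g \<in> {g \<in> bdW p \<eta>. odo_add p g (\<lambda>n. y n - k) \<in> bdW p \<eta>}"
      using i1 by (auto simp: V_set_def m)
  next
    fix g assume g: "g \<in> {g \<in> bdW p \<eta>. odo_add p g (\<lambda>n. y n - k) \<in> bdW p \<eta>}"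
    then have "g = odo_add p (odo_add p g (\<lambda>n. y n - k)) (\<lambda>n. k - y n)" using i2 by simp
    then show "g \<in> V_set p \<eta> y k" using g unfolding V_set_def m by blast
  qed
qed

lemma V_int_open:
  obtains T where "open T" "V_int p \<eta> y k = bdW p \<eta> \<inter> T"
  using openin_interior_of[of "top_of_set (bdW p \<eta>)" "V_set p \<eta> y k"]
  unfolding openin_open V_int_def by blast

lemma V_int_subset: "V_int p \<eta> y k \<subseteq> V_set p \<eta> y k"
  by (simp add: V_int_def interior_of_subset)

text \<open>\<open>no_local_invariance\<close> is the only form in which the arithmetic of the
  essential holes enters the study of automorphisms.\<close>

locale toeplitz_thin_boundary = toeplitz_factor +
  assumes no_local_invariance: "\<And>U k. open U \<Longrightarrow> U \<inter> bdW p \<eta> \<noteq> {} \<Longrightarrow> k \<noteq> 0 \<Longrightarrow>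
    \<exists>g\<in>U \<inter> bdW p \<eta>. odo_add p g (\<lambda>_. k) \<notin> bdW p \<eta>"
begin

lemma nowhere_dense_rel_translate:
  assumes "k \<noteq> 0"
  shows "nowhere_dense_rel (bdW p \<eta>) {g \<in> bdW p \<eta>. odo_add p g (\<lambda>_. k) \<in> bdW p \<eta>}"
  unfolding nowhere_dense_rel_def
proof (intro conjI allI impI)
  show "closed {g \<in> bdW p \<eta>. odo_add p g (\<lambda>_. k) \<in> bdW p \<eta>}"
    using closed_Int[OF closed_bdW closed_odo_add_vimage[OF closed_bdW]] by (simp add: Collect_conj_eq)
  fix T assume "open T" "T \<inter> bdW p \<eta> \<noteq> {}"
  then show "\<not> T \<inter> bdW p \<eta> \<subseteq> {g \<in> bdW p \<eta>. odo_add p g (\<lambda>_. k) \<in> bdW p \<eta>}"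
    using no_local_invariance assms by blast
qed

lemma intersection_translate_nowhere_dense:
  assumes "k \<noteq> 0"
  shows "nowhere_dense_in (top_of_set (bdW p \<eta>)) (bdW p \<eta> \<inter> (\<lambda>g. odo_minus p g (Delta p k)) ` bdW p \<eta>)"
proof -
  \<comment> \<open>The intersection in question is \<open>V_set\<close> for the zero rotation and
    the index \<open>- k\<close>.\<close>
  have "Delta p 0 \<in> odometer p" by (rule Delta_in_odometer[OF toeplitz])
  from V_set_eq[OF toeplitz this, of "- k"]
  have "bdW p \<eta> \<inter> (\<lambda>g. odo_minus p g (Delta p k)) ` bdW p \<eta>
      = {g \<in> bdW p \<eta>. odo_add p g (\<lambda>_. k) \<in> bdW p \<eta>}"
    by (simp add: V_set_def odo_minus_def odo_add_def Delta_def mod_simps)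
  then show ?thesis
    using nowhere_dense_in_of_rel[OF nowhere_dense_rel_translate[OF assms]] by auto
qed

section \<open>Relative interiors of the sets \<open>V_set\<close> for an automorphism\<close>

context
  fixes F :: "(int \<Rightarrow> bool) \<Rightarrow> (int \<Rightarrow> bool)" and m :: nat and y :: "nat \<Rightarrow> int"
  assumes F: "automorphism \<eta> F" and code: "has_block_code \<eta> F m"
  defines "y \<equiv> aut_rotation p \<eta> \<pi> F"
begin

lemma y_in_odometer: "y \<in> odometer p"
  using factor_in_odometer automorphism_in[OF F] translate_orbit[of 0 \<eta>]
  by (simp add: y_def aut_rotation_eq[OF F])

lemma V_set_iff: "g \<in> V_set p \<eta> y k \<longleftrightarrow> g \<in> bdW p \<eta> \<and> odo_add p g (\<lambda>n. y n - k) \<in> bdW p \<eta>"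
  by (simp add: V_set_eq[OF toeplitz y_in_odometer])

lemma rotation_backward: "h \<in> bdW p \<eta> \<Longrightarrow> \<exists>l\<in>{- int m..int m}. odo_add p h (\<lambda>n. l - y n) \<in> bdW p \<eta>"
  using bdW_backward[OF F code] by (simp add: y_def aut_rotation_eq[OF F])

lemma rotation_forward:
  "\<exists>M::nat. \<forall>h\<in>bdW p \<eta>. \<exists>k\<in>{- int M..int M}. odo_add p h (\<lambda>n. y n - k) \<in> bdW p \<eta>"
  using bdW_forward[OF F] by (simp add: y_def aut_rotation_eq[OF F])

text \<open>For \<open>k\<close> outside the window every \<open>l - k\<close> is nonzero, so some
  \<open>h\<close> in the interior has no translate by such an \<open>l - k\<close> in
  \<open>bdW\<close>. But \<open>rotation_backward\<close> at \<open>h + y - k\<close> produces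
  one.\<close>

lemma K_set_subset: "K_set p \<eta> y \<subseteq> {- int m..int m}"
proof
  fix k assume "k \<in> K_set p \<eta> y"
  then have ne: "V_int p \<eta> y k \<noteq> {}" by (simp add: K_set_def)
  obtain T where T: "open T" "V_int p \<eta> y k = bdW p \<eta> \<inter> T" by (rule V_int_open)
  show "k \<in> {- int m..int m}"
  proof (rule ccontr)
    assume k: "k \<notin> {- int m..int m}"
    have "\<exists>h\<in>T \<inter> bdW p \<eta>. \<forall>l\<in>{- int m..int m}.
        h \<notin> {g \<in> bdW p \<eta>. odo_add p g (\<lambda>_. l - k) \<in> bdW p \<eta>}"
      using T ne k by (intro avoid_finite_nowhere_dense nowhere_dense_rel_translate) auto
    then obtain h where h: "h \<in> T" "h \<in> bdW p \<eta>"
      and av: "\<And>l. l \<in> {- int m..int m} \<Longrightarrow> odo_add p h (\<lambda>_. l - k) \<notin> bdW p \<eta>" by blast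
    have "h \<in> V_set p \<eta> y k" using V_int_subset[of p \<eta> y k] h T by blast
    then have "odo_add p h (\<lambda>n. y n - k) \<in> bdW p \<eta>" by (simp add: V_set_iff)
    from rotation_backward[OF this] av show False by (auto simp: odo_add_add)
  qed
qed

text \<open>An overlap of two interiors yields local invariance under \<open>i - j\<close>. Near the
  image \<open>h + y - i\<close> of a generic \<open>h\<close>, boundary points return by
  \<open>i - y\<close> into the overlap, and from there membership in \<open>V_set\<close> for
  \<open>j\<close> leads by \<open>y - j\<close> back into \<open>bdW\<close>.\<close>

lemma V_int_disjoint:
  assumes ij: "i \<noteq> j"
  shows "V_int p \<eta> y i \<inter> V_int p \<eta> y j = {}"
proof (rule ccontr)
  assume ne: "V_int p \<eta> y i \<inter> V_int p \<eta> y j \<noteq> {}"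
  obtain T1 T2 where T1: "open T1" "V_int p \<eta> y i = bdW p \<eta> \<inter> T1"
    and T2: "open T2" "V_int p \<eta> y j = bdW p \<eta> \<inter> T2" by (metis V_int_open)
  \<comment> \<open>Leaving out \<open>i\<close> makes all shifts \<open>l - i\<close> nonzero, as
    genericity requires.\<close>
  define T I where "T = T1 \<inter> T2" and "I = {- int m..int m} - {i}"
  have T: "open T" "T \<inter> bdW p \<eta> \<noteq> {}" using T1 T2 ne by (auto simp: T_def)
  have TV: "g \<in> V_set p \<eta> y i" "g \<in> V_set p \<eta> y j" if "g \<in> T" "g \<in> bdW p \<eta>" for g
    using that V_int_subset[of p \<eta> y i] V_int_subset[of p \<eta> y j] T1 T2 by (auto simp: T_def)
  have "\<exists>h\<in>T \<inter> bdW p \<eta>. \<forall>l\<in>I. h \<notin> {g \<in> bdW p \<eta>. odo_add p g (\<lambda>_. l - i) \<in> bdW p \<eta>}"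
    using T by (intro avoid_finite_nowhere_dense nowhere_dense_rel_translate) (auto simp: I_def)
  then obtain h where h: "h \<in> T" "h \<in> bdW p \<eta>"
    and av: "\<And>l. l \<in> I \<Longrightarrow> odo_add p h (\<lambda>_. l - i) \<notin> bdW p \<eta>" by blast
  define h' where "h' = odo_add p h (\<lambda>n. y n - i)"
  have h': "h' \<in> bdW p \<eta>" using TV(1)[OF h] by (simp add: V_set_iff h'_def)
  \<comment> \<open>For points of \<open>T' \<inter> bdW\<close> the backward shift \<open>l\<close> can only be \<open>i\<close>, so they are translates of points of \<open>T\<close>.\<close>
  define T' where "T' = {g. odo_add p g (\<lambda>n. i - y n) \<in> T}
      \<inter> (\<Inter>l\<in>I. {g. odo_add p g (\<lambda>n. l - y n) \<in> - bdW p \<eta>})"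
  have "open T'" unfolding T'_def
    using T(1) closed_bdW
    by (intro open_Int open_INT open_odo_add_vimage ballI) (auto simp: I_def open_Compl)
  moreover have "h' \<in> T'"
  proof -
    have "odo_add p h' (\<lambda>n. i - y n) = h"
      using odo_add_0 h(2) bdW_subset[OF toeplitz] by (auto simp: h'_def odo_add_add)
    moreover have "odo_add p h' (\<lambda>n. l - y n) = odo_add p h (\<lambda>_. l - i)" for l
      by (simp add: h'_def odo_add_add)
    ultimately show ?thesis using h(1) av by (simp add: T'_def)
  qed
  ultimately obtain g where g: "g \<in> T'" "g \<in> bdW p \<eta>" "odo_add p g (\<lambda>_. i - j) \<notin> bdW p \<eta>"
    using no_local_invariance[of T' "i - j"] h' ij by auto
  obtain l where l: "l \<in> {- int m..int m}" "odo_add p g (\<lambda>n. l - y n) \<in> bdW p \<eta>"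
    using rotation_backward[OF g(2)] by blast
  then have "l = i" using g(1) by (auto simp: T'_def I_def)
  then have "odo_add p g (\<lambda>n. i - y n) \<in> V_set p \<eta> y j"
    using g(1) l(2) TV(2) by (auto simp: T'_def)
  then show False using g(3) by (simp add: V_set_iff odo_add_add)
qed

text \<open>By \<open>rotation_forward\<close> finitely many \<open>V_set\<close> cover
  \<open>bdW\<close>, and each exceeds its relative interior by a nowhere dense set only. A nonempty
  open part of \<open>bdW\<close> missing all the closures would contain a point outside these
  differences, hence in some interior.\<close>

lemma bdW_eq_Union_closure_V_int:
  "bdW p \<eta> = (\<Union>k\<in>K_set p \<eta> y. odometer_top p closure_of V_int p \<eta> y k)"
proof
  have "V_int p \<eta> y k \<subseteq> bdW p \<eta>" for k
    using V_int_subset[of p \<eta> y k] by (auto simp: V_set_def)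
  then show "(\<Union>k\<in>K_set p \<eta> y. odometer_top p closure_of V_int p \<eta> y k) \<subseteq> bdW p \<eta>"
    using closure_of_minimal[OF _ closedin_bdW] by blast
next
  show "bdW p \<eta> \<subseteq> (\<Union>k\<in>K_set p \<eta> y. odometer_top p closure_of V_int p \<eta> y k)"
  proof (rule ccontr)
    assume "\<not> ?thesis"
    then obtain g0 where g0: "g0 \<in> bdW p \<eta>"
      "\<And>k. k \<in> K_set p \<eta> y \<Longrightarrow> g0 \<notin> odometer_top p closure_of V_int p \<eta> y k" by blast
    have sub: "V_int p \<eta> y k \<subseteq> odometer p" for k
      using V_int_subset[of p \<eta> y k] bdW_subset[OF toeplitz] by (auto simp: V_set_def)
    have g0': "g0 \<notin> closure (V_int p \<eta> y k)" if "k \<in> K_set p \<eta> y" for k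
      using g0(2)[OF that] g0(1) bdW_subset[OF toeplitz] sub[of k]
      by (auto simp: closure_of_subtopology Int_absorb1)
    obtain M :: nat where M: "\<And>h. h \<in> bdW p \<eta> \<Longrightarrow> \<exists>k\<in>{- int M..int M}. h \<in> V_set p \<eta> y k"
      using rotation_forward unfolding V_set_iff by blast
    define T where "T = - (\<Union>k\<in>K_set p \<eta> y. closure (V_int p \<eta> y k))"
    have "finite (K_set p \<eta> y)" using K_set_subset finite_subset by blast
    then have T: "open T" unfolding T_def by (intro open_Compl closed_UN) auto
    have "\<exists>g\<in>T \<inter> bdW p \<eta>. \<forall>k\<in>{- int M..int M}. g \<notin> V_set p \<eta> y k - V_int p \<eta> y k"
    proof (rule avoid_finite_nowhere_dense)
      show "T \<inter> bdW p \<eta> \<noteq> {}" using g0(1) g0' by (auto simp: T_def)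
      show "nowhere_dense_rel (bdW p \<eta>) (V_set p \<eta> y k - V_int p \<eta> y k)" for k
        unfolding nowhere_dense_rel_def
      proof (intro conjI allI impI)
        obtain U where U: "open U" "V_int p \<eta> y k = bdW p \<eta> \<inter> U" by (rule V_int_open)
        have "V_set p \<eta> y k - V_int p \<eta> y k
            = bdW p \<eta> \<inter> {g. odo_add p g (\<lambda>n. y n - k) \<in> bdW p \<eta>} \<inter> - U"
          unfolding U(2) using V_set_iff by blast
        then show "closed (V_set p \<eta> y k - V_int p \<eta> y k)"
          using U(1) closed_odo_add_vimage[OF closed_bdW]
          by (simp only:) (intro closed_Int closed_bdW closed_Compl)
        fix T' assume T': "open T'" "T' \<inter> bdW p \<eta> \<noteq> {}"
        show "\<not> T' \<inter> bdW p \<eta> \<subseteq> V_set p \<eta> y k - V_int p \<eta> y k"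
        proof
          assume sub: "T' \<inter> bdW p \<eta> \<subseteq> V_set p \<eta> y k - V_int p \<eta> y k"
          have "openin (top_of_set (bdW p \<eta>)) (T' \<inter> bdW p \<eta>)"
            using T'(1) by (metis Int_commute openin_open_Int)
          then have "T' \<inter> bdW p \<eta> \<subseteq> V_int p \<eta> y k"
            unfolding V_int_def using sub by (intro interior_of_maximal) auto
          then show False using sub T'(2) by blast
        qed
      qed
    qed (use T in auto)
    then obtain g where g: "g \<in> T" "g \<in> bdW p \<eta>"
      "\<And>k. k \<in> {- int M..int M} \<Longrightarrow> g \<notin> V_set p \<eta> y k - V_int p \<eta> y k" by blast
    obtain k where "k \<in> {- int M..int M}" "g \<in> V_set p \<eta> y k" using M[OF g(2)] by blast
    then have k: "g \<in> V_int p \<eta> y k" using g(3) by blast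
    then have "k \<in> K_set p \<eta> y" by (auto simp: K_set_def)
    then show False using k g(1) closure_subset by (auto simp: T_def)
  qed
qed

end

end

theorem proposition2p28:
  fixes p :: "nat \<Rightarrow> nat" and \<eta> :: "int \<Rightarrow> bool"
    and \<pi> :: "(int \<Rightarrow> bool) \<Rightarrow> (nat \<Rightarrow> int)"
    and A :: "nat \<Rightarrow> nat set" and S :: "nat \<Rightarrow> nat \<Rightarrow> nat set"
  assumes "toeplitz p \<eta>"
    and "maximal_equicontinuous_factor (top_of_set (orbit_closure \<eta>)) shift
           (odometer_top p) (odo_T p) \<pi>"
    and "\<pi> \<eta> = Delta p 0"
    and "\<And>n. 0 \<notin> A n" and "\<And>n. primitive_set (A n)"
    and "\<And>n a. a \<in> A n \<Longrightarrow> 0 \<notin> S n a"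
    and "\<And>n. essential_holes p \<eta> n = (\<Union>a\<in>A n. {k. int a dvd k} - multiples (S n a))"
    and "\<And>n a. a \<in> A n \<Longrightarrow> {k. int a dvd k} - multiples (S n a) \<noteq> {}"
    and "(\<lambda>n. \<Sum>\<^sub>\<infinity>a\<in>A n. ennreal (1 / real (totient a))) \<longlonglongrightarrow> 0"
  shows "(\<forall>k. k \<noteq> 0 \<longrightarrow>
            nowhere_dense_in (top_of_set (bdW p \<eta>))
              (bdW p \<eta> \<inter> (\<lambda>g. odo_minus p g (Delta p k)) ` bdW p \<eta>)) \<and>
         (\<forall>F m. automorphism \<eta> F \<and> has_block_code \<eta> F m \<longrightarrow>
            (let y = aut_rotation p \<eta> \<pi> F; K = K_set p \<eta> y in
               K \<subseteq> {- int m..int m} \<and>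
               (\<forall>i\<in>K. \<forall>j\<in>K. i \<noteq> j \<longrightarrow> V_int p \<eta> y i \<inter> V_int p \<eta> y j = {}) \<and>
               bdW p \<eta> = (\<Union>k\<in>K. odometer_top p closure_of V_int p \<eta> y k)))"
proof -
  have factor: "factor_map (top_of_set (orbit_closure \<eta>)) shift (odometer_top p) (odo_T p) \<pi>"
    and c: "compact_space (odometer_top p)"
    using assms(2) by (simp_all add: maximal_equicontinuous_factor_def equicontinuous_system_def)
  interpret toeplitz_thin_boundary p \<eta> \<pi>
  proof
    fix U :: "(nat \<Rightarrow> int) set" and k :: int
    assume U: "open U" "U \<inter> bdW p \<eta> \<noteq> {}" and k: "k \<noteq> 0"
    have o: "openin (odometer_top p) (odometer p \<inter> U)" using U(1) by (rule openin_open_Int)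
    have n: "(odometer p \<inter> U) \<inter> bdW p \<eta> \<noteq> {}" using U(2) bdW_subset[OF assms(1)] by blast
    have "\<exists>g\<in>(odometer p \<inter> U) \<inter> bdW p \<eta>. odo_add p g (\<lambda>_. k) \<notin> bdW p \<eta>"
      by (rule bdW_translate_not_locally_invariant[where A = A and S = S]) (fact assms c k o n)+
    then show "\<exists>g\<in>U \<inter> bdW p \<eta>. odo_add p g (\<lambda>_. k) \<notin> bdW p \<eta>" by auto
  qed (fact assms(1) factor assms(3))+
  show ?thesis
    unfolding Let_def
  proof (intro conjI allI impI ballI)
    fix k :: int assume "k \<noteq> 0"
    then show "nowhere_dense_in (top_of_set (bdW p \<eta>))
        (bdW p \<eta> \<inter> (\<lambda>g. odo_minus p g (Delta p k)) ` bdW p \<eta>)"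
      by (rule intersection_translate_nowhere_dense)
  next
    fix F :: "(int \<Rightarrow> bool) \<Rightarrow> (int \<Rightarrow> bool)" and m :: nat
    assume "automorphism \<eta> F \<and> has_block_code \<eta> F m"
    then have F: "automorphism \<eta> F" "has_block_code \<eta> F m" by simp_all
    let ?y = "aut_rotation p \<eta> \<pi> F"
    show "K_set p \<eta> ?y \<subseteq> {- int m..int m}" by (rule K_set_subset[OF F])
    show "bdW p \<eta> = (\<Union>k\<in>K_set p \<eta> ?y. odometer_top p closure_of V_int p \<eta> ?y k)"
      by (rule bdW_eq_Union_closure_V_int[OF F])
    fix i j :: int assume "i \<noteq> j"
    then show "V_int p \<eta> ?y i \<inter> V_int p \<eta> ?y j = {}" by (rule V_int_disjoint[OF F])
  qed
qed

end
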